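(* Let $R>0$ and $A\in L^2[0,R]$ (complex-valued). Let $\mathfrak{A}(r,\lambda),\mathfrak{B}(r,\lambda)$ be the continuous Wall polynomials of the Krein system with coefficient $A$. Then $$\int_{-\infty}^\infty\ln|\mathfrak{A}(R,\lambda)|\,d\lambda=\pi\int_0^R|A(r)|^2dr$$ and $$2\pi\int_0^R|A(r)|^2dr=-\int_{-\infty}^\infty\ln\left[1-|\mathfrak{B}(R,\lambda)\mathfrak{A}^{-1}(R,\lambda)|^2\right]d\lambda .$$
   Context: For $\lambda\in\mathbb{C}$ let $X(r,\lambda)$ be the $2\times 2$ matrix solution on $[0,R]$ of $X'=\begin{bmatrix}i\lambda&-\overline{A(r)}\\-A(r)&0\end{bmatrix}X$, $X(0,\lambda)=I$. The continuous Wall polynomials $\mathfrak{A},\mathfrak{B}$ are the entries in the second row of $X$: $$X(r,\lambda)=\begin{bmatrix}\mathfrak{A}_*(r,\lambda)&\mathfrak{B}_*(r,\lambda)\\\mathfrak{B}(r,\lambda)&\mathfrak{A}(r,\lambda)\end{bmatrix}.$$ *)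

theory Defs
  imports "HOL-Analysis.Analysis"
begin

text \<open>Absolute continuity of a function of a real variable: the usual epsilon-delta condition
  over finite families of non-overlapping closed intervals contained in \<open>S\<close>. The end points of
  an interval \<open>K = {a..b}\<close> are recovered as \<open>a = Inf K\<close> and \<open>b = Sup K\<close>.\<close>

definition absolutely_continuous_on :: "real set \<Rightarrow> (real \<Rightarrow> 'a::real_normed_vector) \<Rightarrow> bool" where
  "absolutely_continuous_on S f \<longleftrightarrow>
     (\<forall>\<epsilon>>0. \<exists>\<delta>>0. \<forall>D. D division_of \<Union>D \<and> \<Union>D \<subseteq> S \<and> (\<Sum>K\<in>D. measure lborel K) < \<delta>
        \<longrightarrow> (\<Sum>K\<in>D. norm (f (Sup K) - f (Inf K))) < \<epsilon>)"

definition krein_matrix :: "complex \<Rightarrow> complex \<Rightarrow> complex^2^2" where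
  "krein_matrix a z = vector [vector [\<i> * z, - cnj a],
                              vector [- a,     0     ]]"

text \<open>The coefficient is only square integrable, so the Cauchy problem
  \<open>X' = krein_matrix (A r) z ** X\<close>, \<open>X 0 = I\<close> is understood in the sense of Caratheodory:
  \<open>X\<close> is absolutely continuous and the equation holds at almost every point.\<close>

definition krein_solution ::
  "real \<Rightarrow> (real \<Rightarrow> complex) \<Rightarrow> complex \<Rightarrow> (real \<Rightarrow> complex^2^2) \<Rightarrow> bool" where
  "krein_solution R A z X \<longleftrightarrow>
     absolutely_continuous_on {0..R} X \<and>
     (AE r in lebesgue_on {0..R}.
        (X has_vector_derivative (krein_matrix (A r) z ** X r)) (at r within {0..R})) \<and>
     X 0 = mat 1"

text \<open>\<open>PA\<close> and \<open>PB\<close> are the continuous Wall polynomials on \<open>[0, R]\<close>: the second row of the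
  solution is \<open>(PB, PA)\<close>, in this order.\<close>

definition wall_polynomials ::
  "real \<Rightarrow> (real \<Rightarrow> complex) \<Rightarrow>
     (real \<Rightarrow> complex \<Rightarrow> complex) \<Rightarrow> (real \<Rightarrow> complex \<Rightarrow> complex) \<Rightarrow> bool" where
  "wall_polynomials R A PA PB \<longleftrightarrow>
     (\<exists>X. (\<forall>z. krein_solution R A z (\<lambda>r. X r z)) \<and>
          (\<forall>r\<in>{0..R}. \<forall>z. PB r z = X r z $ 2 $ 1 \<and> PA r z = X r z $ 2 $ 2))"

end

(* Write (p, q) for the second column of X(., z). For Im z >= 0 the energy identity
   |q|^2 = 1 + |p|^2 + 2 Im z int |p|^2 gives |q| >= 1, and a Gronwall argument bounds |q|. Hence
   ln |q(R, z)| is bounded, nonnegative and harmonic in the upper half-plane, and Poisson's formula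
   expresses ln |q(R, iy)| through the boundary values ln |q(R, t)|. By monotone convergence the
   integral of ln |q(R, t)| over the line is the limit of pi y ln |q(R, iy)| as y tends to infinity.
   Since q(R, iy) = 1 - int A p and y p(., iy) tends to - conj A weakly in L^2, this limit is
   pi int |A|^2. The second formula follows from |q|^2 - |beta|^2 = 1 on the real line. *)

theory Submission
  imports Defs "HOL-Complex_Analysis.Complex_Analysis"
begin

text \<open>Since \<open>A\<close> is only square integrable, the differential equation holds merely
  almost everywhere, and every use of it passes through an integral identity; this is why a calculus
  of almost-everywhere derivatives with its fundamental theorem comes before everything else. The
  solutions are given for one z at a time, with no assumption on how they depend on z. Continuity
  and holomorphy of q(R, z) come from writing X(., z) - X(., w) as z - w times an integral over the
  second column at z, which is bounded uniformly for Im z >= 0. The bounds 1 <= |q| <= const make ln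
  |q| the real part of a holomorphic function without any growth condition at infinity. The weak
  limit is made quantitative: y p(., iy) is bounded in L^2 uniformly in y, so replacing A by a
  polynomial \<phi> costs a multiple of the L^2 distance that does not depend on y. For fixed
  \<phi>, an integration by parts leaves only terms that vanish as y grows. Hence \<phi> is chosen
  before y.\<close>

section \<open>Absolutely continuous functions on an interval\<close>

lemma absolutely_continuous_onD:
  assumes "absolutely_continuous_on S f" "\<epsilon> > 0"
  obtains \<delta> where "\<delta> > 0"
    "\<And>D. D division_of \<Union>D \<Longrightarrow> \<Union>D \<subseteq> S \<Longrightarrow> (\<Sum>K\<in>D. measure lborel K) < \<delta>
        \<Longrightarrow> (\<Sum>K\<in>D. norm (f (Sup K) - f (Inf K))) < \<epsilon>"
  using assms unfolding absolutely_continuous_on_def by metis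

lemma division_of_real_endpoints:
  fixes D :: "real set set"
  assumes "D division_of \<Union>D" "K \<in> D"
  shows "K = {Inf K..Sup K}" "Inf K \<le> Sup K" "Inf K \<in> \<Union>D" "Sup K \<in> \<Union>D"
    "measure lborel K = Sup K - Inf K"
proof -
  obtain a b where K: "K = cbox a b" "K \<noteq> {}"
    using division_ofD(3,4)[OF assms(1)] assms(2) by blast
  then have ab: "a \<le> b" by auto
  then show "K = {Inf K..Sup K}" "Inf K \<le> Sup K"
    "measure lborel K = Sup K - Inf K" using K by (auto simp: measure_lborel_Icc)
  show "Inf K \<in> \<Union>D" "Sup K \<in> \<Union>D"
    using K ab assms(2) by (auto intro!: bexI[of _ K])
qed

lemma absolutely_continuous_on_subset:
  "absolutely_continuous_on S f \<Longrightarrow> T \<subseteq> S \<Longrightarrow> absolutely_continuous_on T f"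
  unfolding absolutely_continuous_on_def by (meson order_trans)

lemma absolutely_continuous_imp_continuous:
  assumes "absolutely_continuous_on {a..b} f"
  shows "continuous_on {a..b} f"
  unfolding continuous_on_iff
proof (intro ballI allI impI)
  fix x e :: real
  assume x: "x \<in> {a..b}" and e: "e > 0"
  obtain d where d: "d > 0" and *:
    "\<And>D. D division_of \<Union>D \<Longrightarrow> \<Union>D \<subseteq> {a..b} \<Longrightarrow> (\<Sum>K\<in>D. measure lborel K) < d
        \<Longrightarrow> (\<Sum>K\<in>D. norm (f (Sup K) - f (Inf K))) < e"
    using absolutely_continuous_onD[OF assms e] by blast
  have **: "dist (f v) (f u) < e" if "u \<le> v" "u \<in> {a..b}" "v \<in> {a..b}" "v - u < d" for u v
  proof -
    have "{{u..v}} division_of \<Union>{{u..v}}"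
      using division_of_self[of u v] that by (simp add: box_real)
    with *[of "{{u..v}}"] that show ?thesis by (auto simp: dist_norm)
  qed
  show "\<exists>d>0. \<forall>x'\<in>{a..b}. dist x' x < d \<longrightarrow> dist (f x') (f x) < e"
  proof (intro exI[of _ d] conjI ballI impI d)
    fix x' assume "x' \<in> {a..b}" "dist x' x < d"
    then show "dist (f x') (f x) < e"
      using **[of x x'] **[of x' x] x by (cases "x \<le> x'") (auto simp: dist_real_def dist_commute)
  qed
qed

lemma absolutely_continuous_onI_dominated:
  assumes "absolutely_continuous_on S f" "absolutely_continuous_on S g" "C > 0"
    and "\<And>u v. u \<in> S \<Longrightarrow> v \<in> S \<Longrightarrow> norm (h v - h u) \<le> C * (norm (f v - f u) + norm (g v - g u))"
  shows "absolutely_continuous_on S h"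
  unfolding absolutely_continuous_on_def
proof (intro allI impI)
  fix e :: real assume e: "e > 0"
  then have e': "e / (2 * C) > 0" using assms by simp
  obtain d1 where d1: "d1 > 0"
    "\<And>D. D division_of \<Union>D \<Longrightarrow> \<Union>D \<subseteq> S \<Longrightarrow> (\<Sum>K\<in>D. measure lborel K) < d1
        \<Longrightarrow> (\<Sum>K\<in>D. norm (f (Sup K) - f (Inf K))) < e / (2 * C)"
    using absolutely_continuous_onD[OF assms(1) e'] by blast
  obtain d2 where d2: "d2 > 0"
    "\<And>D. D division_of \<Union>D \<Longrightarrow> \<Union>D \<subseteq> S \<Longrightarrow> (\<Sum>K\<in>D. measure lborel K) < d2
        \<Longrightarrow> (\<Sum>K\<in>D. norm (g (Sup K) - g (Inf K))) < e / (2 * C)"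
    using absolutely_continuous_onD[OF assms(2) e'] by blast
  show "\<exists>\<delta>>0. \<forall>D. D division_of \<Union>D \<and> \<Union>D \<subseteq> S \<and> (\<Sum>K\<in>D. measure lborel K) < \<delta>
        \<longrightarrow> (\<Sum>K\<in>D. norm (h (Sup K) - h (Inf K))) < e"
  proof (intro exI[of _ "min d1 d2"] conjI allI impI)
    show "min d1 d2 > 0" using d1(1) d2(1) by simp
    fix D assume D: "D division_of \<Union>D \<and> \<Union>D \<subseteq> S \<and> (\<Sum>K\<in>D. measure lborel K) < min d1 d2"
    have "(\<Sum>K\<in>D. norm (h (Sup K) - h (Inf K)))
        \<le> (\<Sum>K\<in>D. C * (norm (f (Sup K) - f (Inf K)) + norm (g (Sup K) - g (Inf K))))"
    proof (intro sum_mono assms(4))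
      fix K assume "K \<in> D"
      then show "Inf K \<in> S" "Sup K \<in> S"
        using D division_of_real_endpoints(3,4)[OF conjunct1[OF D]] by auto
    qed
    also have "\<dots> = C * ((\<Sum>K\<in>D. norm (f (Sup K) - f (Inf K))) + (\<Sum>K\<in>D. norm (g (Sup K) - g (Inf K))))"
      by (simp only: sum_distrib_left[symmetric] sum.distrib)
    also have "\<dots> < C * (e / (2 * C) + e / (2 * C))"
      using d1(2)[of D] d2(2)[of D] D assms(3) by (intro mult_strict_left_mono add_strict_mono) auto
    also have "\<dots> = e" using assms(3) by simp
    finally show "(\<Sum>K\<in>D. norm (h (Sup K) - h (Inf K))) < e" .
  qed
qed

lemma lipschitz_imp_absolutely_continuous:
  assumes "\<And>u v. u \<in> S \<Longrightarrow> v \<in> S \<Longrightarrow> norm (f v - f u) \<le> C * \<bar>v - u\<bar>"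
  shows "absolutely_continuous_on S f"
  unfolding absolutely_continuous_on_def
proof (intro allI impI)
  fix e :: real assume e: "e > 0"
  \<comment> \<open>The given \<open>C\<close> may be zero or negative, whereas \<open>e\<close> has
    to be divided by a positive constant.\<close>
  let ?C = "\<bar>C\<bar> + 1"
  show "\<exists>\<delta>>0. \<forall>D. D division_of \<Union>D \<and> \<Union>D \<subseteq> S \<and> (\<Sum>K\<in>D. measure lborel K) < \<delta>
        \<longrightarrow> (\<Sum>K\<in>D. norm (f (Sup K) - f (Inf K))) < e"
  proof (intro exI[of _ "e / ?C"] conjI allI impI)
    show "e / ?C > 0" using e by simp
    fix D assume D: "D division_of \<Union>D \<and> \<Union>D \<subseteq> S \<and> (\<Sum>K\<in>D. measure lborel K) < e / ?C"
    have "(\<Sum>K\<in>D. norm (f (Sup K) - f (Inf K))) \<le> (\<Sum>K\<in>D. ?C * measure lborel K)"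
    proof (rule sum_mono)
      fix K assume K: "K \<in> D"
      note E = division_of_real_endpoints[OF conjunct1[OF D] K]
      have "norm (f (Sup K) - f (Inf K)) \<le> C * \<bar>Sup K - Inf K\<bar>"
        using E D by (intro assms) blast+
      also have "\<dots> \<le> ?C * \<bar>Sup K - Inf K\<bar>" by (intro mult_right_mono) auto
      also have "\<dots> = ?C * measure lborel K" using E by simp
      finally show "norm (f (Sup K) - f (Inf K)) \<le> ?C * measure lborel K" .
    qed
    also have "\<dots> = ?C * (\<Sum>K\<in>D. measure lborel K)" by (simp add: sum_distrib_left)
    also have "\<dots> < e" using D by (simp add: pos_less_divide_eq mult.commute)
    finally show "(\<Sum>K\<in>D. norm (f (Sup K) - f (Inf K))) < e" .
  qed
qed

lemma continuous_on_Icc_bounded: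
  fixes f :: "real \<Rightarrow> 'a::real_normed_vector"
  assumes "continuous_on {a..b} f"
  obtains B where "\<And>r. r \<in> {a..b} \<Longrightarrow> norm (f r) \<le> B"
proof -
  have "bounded (f ` {a..b})"
    by (rule compact_imp_bounded[OF compact_continuous_image[OF assms compact_Icc]])
  then show ?thesis unfolding bounded_iff using that by blast
qed

section \<open>Almost-everywhere derivatives: fundamental theorem and product rule\<close>

text \<open>The two analytic clauses of a Caratheodory solution, for values in any normed space, so
  that the matrix and its scalar entries obey the same rules.\<close>

definition ac_deriv :: "real \<Rightarrow> (real \<Rightarrow> 'a::real_normed_vector) \<Rightarrow> (real \<Rightarrow> 'a) \<Rightarrow> bool" where
  "ac_deriv R f f' \<longleftrightarrow> absolutely_continuous_on {0..R} f \<and>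
     (AE r in lebesgue_on {0..R}. (f has_vector_derivative f' r) (at r within {0..R}))"

text \<open>With the exceptional set taken on the whole line, almost-everywhere statements on
  different intervals can be compared pointwise.\<close>

lemma ac_deriv_alt:
  "ac_deriv R f f' \<longleftrightarrow> absolutely_continuous_on {0..R} f \<and>
     (AE r in lebesgue. r \<in> {0..R} \<longrightarrow> (f has_vector_derivative f' r) (at r within {0..R}))"
  unfolding ac_deriv_def by (subst AE_restrict_space_iff) auto

lemma ac_deriv_continuous: "ac_deriv R f f' \<Longrightarrow> continuous_on {0..R} f"
  unfolding ac_deriv_def by (blast intro: absolutely_continuous_imp_continuous)

lemma ac_deriv_subinterval:
  assumes "ac_deriv R f f'" "r \<le> R"
  shows "ac_deriv r f f'"
  unfolding ac_deriv_alt
proof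
  show "absolutely_continuous_on {0..r} f"
    using assms by (auto simp: ac_deriv_def elim: absolutely_continuous_on_subset)
  have "AE s in lebesgue. s \<in> {0..R} \<longrightarrow> (f has_vector_derivative f' s) (at s within {0..R})"
    using assms by (simp add: ac_deriv_alt)
  then show "AE s in lebesgue. s \<in> {0..r} \<longrightarrow> (f has_vector_derivative f' s) (at s within {0..r})"
    by eventually_elim (use assms(2) in \<open>auto elim: has_vector_derivative_within_subset\<close>)
qed

text \<open>Tags in the exceptional null set are handled by absolute continuity: the gauge confines
  their intervals to an open set of small measure.\<close>

theorem ac_deriv_has_integral:
  fixes f :: "real \<Rightarrow> 'a::real_normed_vector"
  assumes f: "ac_deriv R f f'" and R: "0 \<le> R"
  shows "(f' has_integral (f R - f 0)) {0..R}"
proof -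
  from f obtain N where N: "N \<in> null_sets lebesgue"
    and der: "\<And>r. r \<in> {0..R} \<Longrightarrow> r \<notin> N \<Longrightarrow> (f has_vector_derivative f' r) (at r within {0..R})"
    unfolding ac_deriv_alt by (auto simp: eventually_ae_filter)
  have ac: "absolutely_continuous_on {0..R} f" using f by (simp add: ac_deriv_def)
  \<comment> \<open>Setting the integrand to 0 on \<open>N\<close> makes a tag in \<open>N\<close>
    contribute nothing but the increment of \<open>f\<close>.\<close>
  define g where "g r = (if r \<in> N then 0 else f' r)" for r
  have "(g has_integral (f R - f 0)) {0..R}"
    unfolding has_integral_real
  proof (intro allI impI)
    fix e :: real assume e: "e > 0"
    \<comment> \<open>The tags outside \<open>N\<close> contribute at most
      \<open>e1 * R \<le> e / 2\<close>; the \<open>+ 1\<close> covers \<open>R = 0\<close>.\<close>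
    define e1 where "e1 = e / (2 * (R + 1))"
    have e1: "e1 > 0" using e R by (simp add: e1_def)
    have e2: "e / 2 > 0" using e by simp
    obtain d where d: "d > 0" and dac:
      "\<And>D. D division_of \<Union>D \<Longrightarrow> \<Union>D \<subseteq> {0..R} \<Longrightarrow> (\<Sum>K\<in>D. measure lborel K) < d
        \<Longrightarrow> (\<Sum>K\<in>D. norm (f (Sup K) - f (Inf K))) < e / 2"
      using absolutely_continuous_onD[OF ac e2] by blast
    obtain T where T: "open T" "N \<subseteq> T" "T - N \<in> lmeasurable" "emeasure lebesgue (T - N) < ennreal d"
      using sets_lebesgue_outer_open[of N d] N d by blast
    have Tm: "T \<in> lmeasurable" "measure lebesgue T < d"
    proof -
      have "T = (T - N) \<union> N" using T by auto
      moreover have Nm: "N \<in> lmeasurable" using N by (simp add: fmeasurableI_null_sets)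
      ultimately show "T \<in> lmeasurable" using T(3) by (metis fmeasurable.Un)
      have "emeasure lebesgue T = emeasure lebesgue (T - N)"
        using N T(3) by (metis \<open>T = T - N \<union> N\<close> emeasure_Un_null_set fmeasurableD)
      then have "ennreal (measure lebesgue T) < ennreal d"
        using T(4) emeasure_eq_measure2[OF \<open>T \<in> lmeasurable\<close>] by simp
      then show "measure lebesgue T < d" by (simp add: ennreal_less_iff)
    qed
    have "\<exists>\<delta>>0. ball r \<delta> \<subseteq> T" if "r \<in> N" for r
      using T that open_contains_ball by blast
    then obtain \<delta>1 where \<delta>1: "\<And>r. r \<in> N \<Longrightarrow> \<delta>1 r > 0 \<and> ball r (\<delta>1 r) \<subseteq> T" by metis
    have "\<exists>\<delta>>0. \<forall>y\<in>{0..R}. \<bar>y - r\<bar> < \<delta> \<longrightarrow> norm (f y - f r - (y - r) *\<^sub>R f' r) \<le> e1 * \<bar>y - r\<bar>"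
      if "r \<in> {0..R} - N" for r
      using der[of r] that e1
      unfolding has_vector_derivative_def has_derivative_within_alt by (auto simp: real_norm_def)
    then obtain \<delta>2 where \<delta>2: "\<And>r. r \<in> {0..R} - N \<Longrightarrow> \<delta>2 r > 0 \<and>
        (\<forall>y\<in>{0..R}. \<bar>y - r\<bar> < \<delta>2 r \<longrightarrow> norm (f y - f r - (y - r) *\<^sub>R f' r) \<le> e1 * \<bar>y - r\<bar>)" by metis
    define \<gamma> where "\<gamma> r = ball r (if r \<in> N then \<delta>1 r else if r \<in> {0..R} then \<delta>2 r else 1)" for r
    have gau: "gauge \<gamma>" unfolding \<gamma>_def using \<delta>1 \<delta>2 by (intro gauge_ball_dependent) auto
    have "norm ((\<Sum>(x, k)\<in>D. measure lborel k *\<^sub>R g x) - (f R - f 0)) < e"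
      if D: "D tagged_division_of {0..R}" "\<gamma> fine D" for D
    proof -
      have fin: "finite D" using D(1) by blast
      define D1 where "D1 = {(x,K)\<in>D. x \<in> N}"
      have sub: "D1 \<subseteq> D" by (auto simp: D1_def)
      have fin1: "finite D1" using fin sub finite_subset by blast
      have DK: "K = {Inf K..Sup K} \<and> Inf K \<le> x \<and> x \<le> Sup K \<and> Inf K \<in> {0..R} \<and> Sup K \<in> {0..R} \<and> x \<in> {0..R}
          \<and> measure lborel K = Sup K - Inf K \<and> Inf K \<in> K \<and> Sup K \<in> K"
        if xK: "(x, K) \<in> D" for x K
      proof -
        obtain a b where K: "K = cbox a b" using D(1) xK by blast
        have x: "x \<in> K" "K \<subseteq> {0..R}" using D(1) xK by blast+
        have "a \<le> b" using x K by auto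
        then show ?thesis using K x by auto
      qed
      \<comment> \<open>Straddle estimate: the errors at the two end points are at most
        \<open>e1\<close> times their distances to the tag, and these distances add up to the length
        because the tag lies between them.\<close>
      have est: "norm (measure lborel K *\<^sub>R g x - (f (Sup K) - f (Inf K))) \<le> e1 * measure lborel K"
        if xK: "(x, K) \<in> D - D1" for x K
      proof -
        have xN: "x \<notin> N" using xK by (auto simp: D1_def)
        have DK': "Inf K \<le> x" "x \<le> Sup K" "Inf K \<in> {0..R}" "Sup K \<in> {0..R}" "x \<in> {0..R}"
          "measure lborel K = Sup K - Inf K" "Inf K \<in> K" "Sup K \<in> K" using DK[of x K] xK by auto
        have "K \<subseteq> \<gamma> x" using D(2) xK by (auto dest: fineD)
        then have "\<bar>Inf K - x\<bar> < \<delta>2 x" "\<bar>Sup K - x\<bar> < \<delta>2 x"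
          using DK' xN by (auto simp: \<gamma>_def subset_iff dist_real_def abs_minus_commute)
        then have "norm (f (Inf K) - f x - (Inf K - x) *\<^sub>R f' x) \<le> e1 * \<bar>Inf K - x\<bar>"
          "norm (f (Sup K) - f x - (Sup K - x) *\<^sub>R f' x) \<le> e1 * \<bar>Sup K - x\<bar>"
          using \<delta>2[THEN conjunct2, rule_format, of x] DK' xN by blast+
        moreover have "measure lborel K *\<^sub>R g x - (f (Sup K) - f (Inf K)) =
          (f (Inf K) - f x - (Inf K - x) *\<^sub>R f' x) - (f (Sup K) - f x - (Sup K - x) *\<^sub>R f' x)"
          unfolding DK'(6) using xN by (simp add: g_def algebra_simps)
        ultimately have "norm (measure lborel K *\<^sub>R g x - (f (Sup K) - f (Inf K))) \<le> e1 * \<bar>Inf K - x\<bar> + e1 * \<bar>Sup K - x\<bar>"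
          by (simp only:) (rule order_trans[OF norm_triangle_ineq4 add_mono])
        also have "\<dots> = e1 * measure lborel K" unfolding DK'(6) using DK'(1,2) by (simp add: algebra_simps)
        finally show ?thesis .
      qed
      have tp: "D1 tagged_partial_division_of {0..R}"
        using D(1) by (intro tagged_partial_division_subset[OF _ sub]) (simp add: tagged_division_of_def)
      \<comment> \<open>Passing from a sum over tagged pairs to a sum over intervals requires a
        summand that vanishes on degenerate boxes. \<open>Sup {}\<close> and \<open>Inf {}\<close>
        need not give equal values of \<open>f\<close>, so the empty box is assigned 0 by
        hand.\<close>
      define \<Delta> where "\<Delta> K = (if K = {} then 0 else norm (f (Sup K) - f (Inf K)))" for K
      have null: "\<Delta> (cbox u v) = 0" if "box u v = {}" for u v
        using that by (cases "u = v") (auto simp: \<Delta>_def box_eq_empty)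
      have \<Delta>: "\<Delta> K = norm (f (Sup K) - f (Inf K))" if "(x, K) \<in> D1" for x K
        using DK[of x K] that sub by (auto simp: \<Delta>_def)
      have div: "snd ` D1 division_of \<Union>(snd ` D1)"
        by (rule partial_division_of_tagged_division[OF tp])
      have "(\<Sum>K\<in>snd ` D1. measure lborel K) < d"
      proof -
        have "(\<Sum>K\<in>snd ` D1. measure lborel K) = (\<Sum>K\<in>snd ` D1. measure lebesgue K)"
        proof (rule sum.cong[OF refl])
          fix K assume "K \<in> snd ` D1"
          then have "K \<in> sets lborel"
            by (subst division_of_real_endpoints(1)[OF div]) auto
          then show "measure lborel K = measure lebesgue K" by (simp add: measure_completion)
        qed
        also have "\<dots> = measure lebesgue (\<Union>(snd ` D1))" by (rule content_division[OF div])
        also have "\<dots> \<le> measure lebesgue T"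
        proof (rule measure_mono_fmeasurable)
          show "\<Union>(snd ` D1) \<subseteq> T"
          proof
            fix y assume "y \<in> \<Union>(snd ` D1)"
            then obtain x K where xK: "(x,K) \<in> D" "x \<in> N" "y \<in> K" by (auto simp: D1_def)
            then have "y \<in> \<gamma> x" using D(2) by (auto dest: fineD)
            then show "y \<in> T" using xK \<delta>1[of x] by (auto simp: \<gamma>_def)
          qed
          show "\<Union>(snd ` D1) \<in> sets lebesgue" using lmeasurable_division[OF div] by blast
        qed (rule Tm)
        finally show ?thesis using Tm by linarith
      qed
      moreover have "\<Union>(snd ` D1) \<subseteq> {0..R}" using D(1) sub by fastforce
      ultimately have "(\<Sum>K\<in>snd ` D1. norm (f (Sup K) - f (Inf K))) < e / 2"
        by (intro dac div)
      moreover have "(\<Sum>(x,K)\<in>D1. norm (f (Sup K) - f (Inf K))) = (\<Sum>K\<in>snd ` D1. norm (f (Sup K) - f (Inf K)))"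
      proof -
        have "(\<Sum>(x,K)\<in>D1. \<Delta> K) = sum \<Delta> (snd ` D1)"
          by (rule sum.over_tagged_division_lemma[OF tagged_partial_division_of_Union_self[OF tp]]) (rule null)
        moreover have "(\<Sum>(x,K)\<in>D1. \<Delta> K) = (\<Sum>(x,K)\<in>D1. norm (f (Sup K) - f (Inf K)))"
          by (intro sum.cong refl) (auto simp: \<Delta>)
        moreover have "sum \<Delta> (snd ` D1) = (\<Sum>K\<in>snd ` D1. norm (f (Sup K) - f (Inf K)))"
          by (intro sum.cong refl) (auto simp: \<Delta>)
        ultimately show ?thesis by simp
      qed
      ultimately have s1: "(\<Sum>(x,K)\<in>D1. norm (f (Sup K) - f (Inf K))) < e / 2" by simp
      have "(\<Sum>(x, k)\<in>D. measure lborel k *\<^sub>R g x) - (f R - f 0)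
          = (\<Sum>(x, k)\<in>D. measure lborel k *\<^sub>R g x - (f (Sup k) - f (Inf k)))"
        unfolding additive_tagged_division_1[OF R D(1), of f, symmetric]
        by (simp add: sum_subtractf case_prod_unfold)
      also have "norm \<dots> \<le> (\<Sum>(x, k)\<in>D. norm (measure lborel k *\<^sub>R g x - (f (Sup k) - f (Inf k))))"
        unfolding case_prod_unfold by (rule norm_sum)
      also have "\<dots> = (\<Sum>(x, k)\<in>D1. norm (measure lborel k *\<^sub>R g x - (f (Sup k) - f (Inf k))))
            + (\<Sum>(x, k)\<in>D - D1. norm (measure lborel k *\<^sub>R g x - (f (Sup k) - f (Inf k))))"
        using sum.subset_diff[OF sub fin] by (simp add: add.commute)
      also have "(\<Sum>(x, k)\<in>D1. norm (measure lborel k *\<^sub>R g x - (f (Sup k) - f (Inf k))))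
          = (\<Sum>(x, k)\<in>D1. norm (f (Sup k) - f (Inf k)))"
        by (intro sum.cong refl) (auto simp: D1_def g_def norm_minus_commute)
      also have "(\<Sum>(x, k)\<in>D - D1. norm (measure lborel k *\<^sub>R g x - (f (Sup k) - f (Inf k)))) \<le> (\<Sum>(x, k)\<in>D - D1. e1 * measure lborel k)"
        using est by (intro sum_mono) auto
      also have "\<dots> \<le> (\<Sum>(x, k)\<in>D. e1 * measure lborel k)"
        using fin e1 by (intro sum_mono2) auto
      also have "\<dots> = e1 * measure lborel {0..R}"
        using additive_content_tagged_division[of D 0 R] D(1)
        by (simp add: case_prod_unfold flip: sum_distrib_left)
      also have "\<dots> \<le> e / 2"
        using R e by (simp add: e1_def field_simps)
      finally show ?thesis using s1 by linarith
    qed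
    with gau show "\<exists>\<gamma>. gauge \<gamma> \<and> (\<forall>D. D tagged_division_of {0..R} \<and> \<gamma> fine D \<longrightarrow>
        norm ((\<Sum>(x, k)\<in>D. measure lborel k *\<^sub>R g x) - (f R - f 0)) < e)"
      by (intro exI[of _ \<gamma>] conjI allI impI) simp_all
  qed
  moreover have "negligible N" using N by (simp add: negligible_iff_null_sets)
  ultimately show ?thesis
    using has_integral_spike[of N "{0..R}" f' g] by (simp add: g_def)
qed

lemma ac_deriv_cong:
  "ac_deriv R f f' \<Longrightarrow> (\<And>r. f' r = g' r) \<Longrightarrow> ac_deriv R f g'"
  by (metis ext)

lemma ac_deriv_smooth:
  fixes f :: "real \<Rightarrow> 'a::real_normed_vector"
  assumes "\<And>r. (f has_vector_derivative f' r) (at r)" "continuous_on UNIV f'"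
  shows "ac_deriv R f f'"
  unfolding ac_deriv_def
proof (intro conjI AE_I2)
  obtain B where B: "\<And>r. r \<in> {0..R} \<Longrightarrow> norm (f' r) \<le> B"
    using continuous_on_Icc_bounded[OF continuous_on_subset[OF assms(2)]] by auto
  show "absolutely_continuous_on {0..R} f"
  proof (rule lipschitz_imp_absolutely_continuous[where C = B])
    fix u v :: real assume "u \<in> {0..R}" "v \<in> {0..R}"
    moreover have "onorm (\<lambda>t. t *\<^sub>R f' x) \<le> B" if "x \<in> {0..R}" for x
      by (intro onorm_le) (simp add: mult.commute[of B] mult_left_mono B[OF that])
    ultimately have "norm (f v - f u) \<le> B * norm (v - u)"
      using has_vector_derivative_at_within[OF assms(1)]
      by (intro differentiable_bound[of "{0..R}" f "\<lambda>x t. t *\<^sub>R f' x"])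
         (auto simp: has_vector_derivative_def)
    then show "norm (f v - f u) \<le> B * \<bar>v - u\<bar>" by simp
  qed
  show "(f has_vector_derivative f' r) (at r within {0..R})" for r
    using assms(1) has_vector_derivative_at_within by blast
qed

text \<open>Besides the pointwise product rule, absolute continuity of a product needs both factors
  bounded, which continuity on the compact interval supplies.\<close>

lemma ac_deriv_bilinear:
  assumes bil: "bounded_bilinear pr" and f: "ac_deriv R f f'" and g: "ac_deriv R g g'"
  shows "ac_deriv R (\<lambda>r. pr (f r) (g r)) (\<lambda>r. pr (f r) (g' r) + pr (f' r) (g r))"
  unfolding ac_deriv_alt
proof
  interpret bounded_bilinear pr by (rule bil)
  show "AE r in lebesgue. r \<in> {0..R} \<longrightarrow>
      ((\<lambda>r. pr (f r) (g r)) has_vector_derivative pr (f r) (g' r) + pr (f' r) (g r)) (at r within {0..R})"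
    using conjunct2[OF f[unfolded ac_deriv_alt]] conjunct2[OF g[unfolded ac_deriv_alt]]
    by eventually_elim (auto intro: has_vector_derivative)
  obtain Bf where Bf: "\<And>r. r \<in> {0..R} \<Longrightarrow> norm (f r) \<le> Bf"
    using continuous_on_Icc_bounded[OF ac_deriv_continuous[OF f]] by auto
  obtain Bg where Bg: "\<And>r. r \<in> {0..R} \<Longrightarrow> norm (g r) \<le> Bg"
    using continuous_on_Icc_bounded[OF ac_deriv_continuous[OF g]] by auto
  obtain K where K: "\<And>a b. norm (pr a b) \<le> norm a * norm b * K" "K > 0" using pos_bounded by blast
  let ?C = "K * (\<bar>Bf\<bar> + \<bar>Bg\<bar> + 1)"
  show "absolutely_continuous_on {0..R} (\<lambda>r. pr (f r) (g r))"
  proof (rule absolutely_continuous_onI_dominated[where f = f and g = g and C = ?C])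
    fix u v assume uv: "u \<in> {0..R}" "v \<in> {0..R}"
    have "pr (f v) (g v) - pr (f u) (g u) = pr (f v) (g v - g u) + pr (f v - f u) (g u)"
      by (simp add: diff_left diff_right)
    also have "norm \<dots> \<le> norm (f v) * norm (g v - g u) * K + norm (f v - f u) * norm (g u) * K"
      by (intro norm_triangle_mono K)
    also have "\<dots> \<le> (\<bar>Bf\<bar> + \<bar>Bg\<bar> + 1) * norm (g v - g u) * K + norm (f v - f u) * (\<bar>Bf\<bar> + \<bar>Bg\<bar> + 1) * K"
      using Bf[OF uv(2)] Bg[OF uv(1)] K(2)
      by (intro add_mono mult_right_mono mult_left_mono) auto
    finally show "norm (pr (f v) (g v) - pr (f u) (g u)) \<le> ?C * (norm (f v - f u) + norm (g v - g u))"
      by (simp add: algebra_simps)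
  qed (use f g K in \<open>auto simp: ac_deriv_def\<close>)
qed

lemmas ac_deriv_mult = ac_deriv_bilinear[OF bounded_bilinear_mult]

lemma ac_deriv_linear:
  assumes lin: "bounded_linear f" and g: "ac_deriv R g g'"
  shows "ac_deriv R (\<lambda>r. f (g r)) (\<lambda>r. f (g' r))"
  unfolding ac_deriv_alt
proof
  interpret bounded_linear f by (rule lin)
  show "AE r in lebesgue. r \<in> {0..R} \<longrightarrow>
      ((\<lambda>r. f (g r)) has_vector_derivative f (g' r)) (at r within {0..R})"
    using conjunct2[OF g[unfolded ac_deriv_alt]]
    by eventually_elim (auto intro: has_vector_derivative)
  obtain K where K: "K > 0" "\<And>x. norm (f x) \<le> norm x * K" using pos_bounded by blast
  show "absolutely_continuous_on {0..R} (\<lambda>r. f (g r))"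
    by (rule absolutely_continuous_onI_dominated[where f = g and g = g and C = K])
       (use g K in \<open>auto simp: ac_deriv_def algebra_simps simp flip: diff intro!: order_trans[OF K(2)]\<close>)
qed

lemma ac_deriv_add:
  assumes f: "ac_deriv R f f'" and g: "ac_deriv R g g'"
  shows "ac_deriv R (\<lambda>r. f r + g r) (\<lambda>r. f' r + g' r)"
  unfolding ac_deriv_alt
proof
  show "AE r in lebesgue. r \<in> {0..R} \<longrightarrow>
      ((\<lambda>r. f r + g r) has_vector_derivative f' r + g' r) (at r within {0..R})"
    using conjunct2[OF f[unfolded ac_deriv_alt]] conjunct2[OF g[unfolded ac_deriv_alt]]
    by eventually_elim (auto intro: has_vector_derivative_add)
  show "absolutely_continuous_on {0..R} (\<lambda>r. f r + g r)"
    by (rule absolutely_continuous_onI_dominated[where f = f and g = g and C = 1])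
       (use f g in \<open>auto simp: ac_deriv_def add_diff_add intro: norm_triangle_ineq\<close>)
qed

lemma ac_deriv_diff:
  assumes f: "ac_deriv R f f'" and g: "ac_deriv R g g'"
  shows "ac_deriv R (\<lambda>r. f r - g r) (\<lambda>r. f' r - g' r)"
  using ac_deriv_add[OF f ac_deriv_linear[OF bounded_linear_minus[OF bounded_linear_ident] g]]
  by simp

lemmas ac_deriv_cnj = ac_deriv_linear[OF bounded_linear_cnj]

section \<open>Poisson's formula in the upper half-plane\<close>

text \<open>Cauchy's formula at the centre: for u = \<rho> exp(2 \<pi> \<i> x) the measure du / (2
  \<pi> \<i> u) is dx, so the angle is parametrised by [0, 1].\<close>

lemma mean_value_circle:
  assumes h: "h holomorphic_on cball 0 \<rho>" and \<rho>: "\<rho> > 0"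
  shows "((\<lambda>x::real. h (\<rho> * exp (2 * pi * \<i> * of_real x))) has_integral h 0) {0..1}"
proof -
  have "((\<lambda>u. h u / (u - 0)) has_contour_integral (2 * of_real pi * \<i> * h 0)) (circlepath 0 \<rho>)"
    using h \<rho> by (intro Cauchy_integral_circlepath_simple) auto
  then have "((\<lambda>x. h (circlepath 0 \<rho> x) / circlepath 0 \<rho> x * vector_derivative (circlepath 0 \<rho>) (at x within {0..1}))
      has_integral (2 * of_real pi * \<i> * h 0)) {0..1}"
    unfolding has_contour_integral_def by simp
  then have "((\<lambda>x::real. (2 * of_real pi * \<i>) * h (\<rho> * exp (2 * pi * \<i> * of_real x))) has_integral (2 * of_real pi * \<i> * h 0)) {0..1}"
  proof (rule has_integral_eq[rotated])
    fix x :: real assume x: "x \<in> {0..1}"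
    show "h (circlepath 0 \<rho> x) / circlepath 0 \<rho> x * vector_derivative (circlepath 0 \<rho>) (at x within {0..1})
       = (2 * of_real pi * \<i>) * h (\<rho> * exp (2 * pi * \<i> * of_real x))"
      using x \<rho> vector_derivative_circlepath01[of x 0 \<rho>]
      by (simp add: circlepath field_simps)
  qed
  from has_integral_mult_right[OF this, of "1 / (2 * of_real pi * \<i>)"] show ?thesis
    by (simp add: field_simps)
qed

text \<open>The Cayley transform \<open>w \<mapsto> \<i> y (1 + w) / (1 - w)\<close> reduces the Poisson formula to the mean value
  property; as \<open>ln \<bar>F\<bar>\<close> is bounded, the missing boundary point \<open>w = 1\<close> does no harm.\<close>

theorem poisson_half_plane_ln_norm:
  fixes F :: "complex \<Rightarrow> complex"
  assumes hol: "F holomorphic_on {z. Im z > 0}"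
    and cont: "continuous_on {z. Im z \<ge> 0} F"
    and bd: "\<And>z. Im z \<ge> 0 \<Longrightarrow> 1 \<le> norm (F z) \<and> norm (F z) \<le> C"
    and y: "y > 0"
  shows "(\<lambda>t::real. y / (pi * (y\<^sup>2 + t\<^sup>2)) * ln (norm (F t))) absolutely_integrable_on UNIV"
    and "integral UNIV (\<lambda>t::real. y / (pi * (y\<^sup>2 + t\<^sup>2)) * ln (norm (F t))) = ln (norm (F (\<i> * y)))"
proof -
  define c where "c w = \<i> * y * (1 + w) / (1 - w)" for w :: complex
  \<comment> \<open>At \<open>w = 1\<close> division by zero makes \<open>c 1 = 0\<close> and the
    right-hand side 0, so this formula, and with it \<open>c_ge\<close>, holds there too.\<close>
  have Imc: "Im (c w) = y * (1 - (norm w)\<^sup>2) / (norm (1 - w))\<^sup>2" for w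
    unfolding c_def cmod_power2 by (simp add: Im_divide power2_eq_square algebra_simps)
  have c_ge: "Im (c w) \<ge> 0" if "norm w \<le> 1" for w
    unfolding Imc using that y by (simp add: power_le_one)
  have c_gt: "Im (c w) > 0" if "norm w < 1" for w
  proof -
    have "(norm w)\<^sup>2 < 1" using that by (simp add: power_less_one_iff)
    moreover have "w \<noteq> 1" using that by auto
    ultimately show ?thesis unfolding Imc using y by simp
  qed
  have "F \<circ> c holomorphic_on ball 0 1"
    using c_gt unfolding c_def
    by (intro holomorphic_on_compose_gen[OF _ hol] holomorphic_intros) auto
  moreover have "(F \<circ> c) w \<noteq> 0" if "w \<in> ball 0 1" for w
    using bd[of "c w"] c_gt[of w] that by auto
  \<comment> \<open>As \<open>F \<circ> c\<close> has no zero on the disc it has a holomorphic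
    logarithm, whose real part is ln |F \<circ> c|; the mean value property is applied to this
    logarithm.\<close>
  ultimately obtain h where h: "h holomorphic_on ball 0 1" "\<And>w. w \<in> ball 0 1 \<Longrightarrow> exp (h w) = (F \<circ> c) w"
    using holomorphic_logarithm_exists[of "ball 0 1" "F \<circ> c" 0] by (auto simp: convex_ball)
  have Re_h: "Re (h w) = ln (norm (F (c w)))" if "norm w < 1" for w
  proof -
    have "norm (F (c w)) = exp (Re (h w))" using h(2)[of w] that by (metis comp_apply mem_ball_0 norm_exp_eq_Re)
    then show ?thesis by simp
  qed
  define e where "e x = exp (2 * pi * \<i> * of_real x)" for x :: real
  have norm_e: "norm (e x) = 1" for x by (simp add: e_def norm_exp_eq_Re)
  have e1: "e x \<noteq> 1" if "x \<in> {0<..<1}" for x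
  proof
    assume "e x = 1"
    then obtain n :: int where "2 * pi * x = of_int (2 * n) * pi"
      unfolding e_def exp_eq_1 by auto
    then have "x = of_int n" by simp
    with that have "0 < n" "n < 1" by auto
    then show False by linarith
  qed
  \<comment> \<open>The shifted indices keep every radius strictly between 0 and 1, already for
    \<open>n = 0\<close>, so the closed discs lie in the domain of \<open>h\<close>.\<close>
  define \<rho> where "\<rho> n = real (Suc n) / real (Suc (Suc n))" for n
  have \<rho>: "0 < \<rho> n" "\<rho> n < 1" for n by (auto simp: \<rho>_def field_simps)
  have \<rho>_lim: "\<rho> \<longlonglongrightarrow> 1" unfolding \<rho>_def using LIMSEQ_Suc[OF LIMSEQ_n_over_Suc_n] by simp
  define u where "u n x = Re (h (\<rho> n * e x))" for n x
  define L where "L x = ln (norm (F (c (e x))))" for x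
  have norm_re: "norm (\<rho> n * e x) < 1" for n x using \<rho>[of n] by (simp add: norm_mult norm_e)
  have u: "(u n has_integral Re (h 0)) {0<..<1}" for n
  proof -
    have "h holomorphic_on cball 0 (\<rho> n)" using \<rho>[of n] by (intro holomorphic_on_subset[OF h(1)]) auto
    from has_integral_Re[OF mean_value_circle[OF this \<rho>(1)]] show ?thesis
      unfolding u_def e_def has_integral_Icc_iff_Ioo .
  qed

  have lim: "(\<lambda>n. u n x) \<longlonglongrightarrow> L x" if x: "x \<in> {0<..<1}" for x
  proof -
    have ne: "1 - e x \<noteq> 0" using e1[OF x] by simp
    have "(\<lambda>n. c (\<rho> n * e x)) \<longlonglongrightarrow> c (1 * e x)"
    proof (rule isCont_tendsto_compose[where g = c])
      show "isCont c (1 * e x)" unfolding c_def using ne by (intro continuous_intros) simp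
      show "(\<lambda>n. \<rho> n * e x) \<longlonglongrightarrow> 1 * e x"
        using tendsto_mult[OF tendsto_of_real[OF \<rho>_lim] tendsto_const] by simp
    qed
    then have "(\<lambda>n. F (c (\<rho> n * e x))) \<longlonglongrightarrow> F (c (e x))"
      using c_ge[of "e x"] norm_e[of x] c_ge[OF less_imp_le[OF norm_re]]
      by (intro continuous_on_tendsto_compose[OF cont]) auto
    moreover have "F (c (e x)) \<noteq> 0" using bd[of "c (e x)"] c_ge[of "e x"] norm_e[of x] by auto
    ultimately have "(\<lambda>n. ln (norm (F (c (\<rho> n * e x))))) \<longlonglongrightarrow> L x"
      unfolding L_def by (intro tendsto_ln tendsto_norm) auto
    then show ?thesis unfolding u_def using Re_h[OF norm_re] by simp
  qed
  \<comment> \<open>Both bounds on |F| enter: 0 <= ln |F| <= ln C provides a constant majorant for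
    the passage to the boundary.\<close>
  have bound: "norm (u n x) \<le> ln C" for n x
    unfolding u_def Re_h[OF norm_re]
    using bd[of "c (\<rho> n * e x)"] c_gt[OF norm_re[of n x]]
    by (auto intro!: ln_mono)
  have const: "(\<lambda>x. ln C) integrable_on {0<..<1::real}"
    using integrable_const_ivl[of "ln C" 0 "1::real"] by (simp only: integrable_on_Icc_iff_Ioo)
  have uI: "u n integrable_on {0<..<1}" for n using u by blast
  have L1: "L integrable_on {0<..<1}"
    by (rule dominated_convergence(1)[OF uI const bound lim])
  have "(\<lambda>n. integral {0<..<1} (u n)) \<longlonglongrightarrow> integral {0<..<1} L"
    by (rule dominated_convergence(2)[OF uI const bound lim])
  moreover have "integral {0<..<1} (u n) = Re (h 0)" for n using u by (rule integral_unique)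
  ultimately have L2: "integral {0<..<1} L = Re (h 0)" by (simp add: LIMSEQ_const_iff)
  also have "\<dots> = ln (norm (F (\<i> * y)))" by (subst Re_h) (auto simp: c_def)
  finally have L2: "integral {0<..<1} L = ln (norm (F (\<i> * y)))" .
  have "L x \<ge> 0" for x
    unfolding L_def using bd[of "c (e x)"] c_ge[of "e x"] norm_e[of x] by auto
  then have L3: "L absolutely_integrable_on {0<..<1}"
    by (intro nonnegative_absolutely_integrable_1[OF L1])
  \<comment> \<open>The inverse of the boundary map: \<open>e (g t)\<close> is the point of the
    circle that the Cayley transform sends to \<open>t\<close>. It maps the line onto the open
    interval (0, 1), and its derivative is the Poisson kernel at height \<open>y\<close>.\<close>
  define g where "g t = 1 / 2 + arctan (t / y) / pi" for t
  have cg: "c (e (g t)) = of_real t" for t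
  proof -
    define s where "s = t / y"
    define \<theta> where "\<theta> = arctan s"
    let ?q = "sqrt (1 + s\<^sup>2)"
    have q: "?q > 0" by (simp add: add_pos_nonneg)
    have "cis \<theta> = (1 + \<i> * s) / ?q"
      by (simp add: complex_eq_iff \<theta>_def cos_arctan sin_arctan)
    moreover have "cis (2 * \<theta>) = (cis \<theta>)\<^sup>2" by (simp add: cis_mult power2_eq_square)
    ultimately have "cis (2 * \<theta>) = (1 + \<i> * s)\<^sup>2 / (of_real (?q\<^sup>2))"
      by (simp only: power_divide of_real_power)
    also have "of_real (?q\<^sup>2) = (1 + \<i> * s) * (1 - \<i> * of_real s)"
      by (simp add: algebra_simps power2_eq_square)
    finally have c2: "cis (2 * \<theta>) = (1 + \<i> * s) / (1 - \<i> * s)"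
      by (simp add: power2_eq_square)
    have "e (g t) = cis (pi + 2 * \<theta>)"
    proof -
      have "2 * pi * g t = pi + 2 * \<theta>" by (simp add: g_def \<theta>_def s_def field_simps)
      then have "2 * pi * \<i> * of_real (g t) = \<i> * complex_of_real (pi + 2 * \<theta>)"
        by (metis mult.commute mult.left_commute of_real_mult of_real_numeral)
      then show ?thesis by (simp only: e_def cis_conv_exp)
    qed
    also have "\<dots> = - cis (2 * \<theta>)" by (simp add: cis_mult[symmetric])
    finally have eg: "e (g t) = - ((1 + \<i> * s) / (1 - \<i> * s))" unfolding c2 .
    have nz: "1 - \<i> * of_real s \<noteq> 0" by (simp add: complex_eq_iff)
    have w: "1 + e (g t) = - 2 * \<i> * s / (1 - \<i> * s)" "1 - e (g t) = 2 / (1 - \<i> * s)"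
      unfolding eg using nz by (simp_all add: field_simps)
    have "c (e (g t)) = of_real (y * s)"
      unfolding c_def w using nz by simp (simp add: complex_eq_iff)
    then show ?thesis using y by (simp add: s_def)
  qed
  have der: "(g has_field_derivative y / (pi * (y\<^sup>2 + t\<^sup>2))) (at t within UNIV)" for t
  proof -
    have "1 + (t / y)\<^sup>2 = (y\<^sup>2 + t\<^sup>2) / y\<^sup>2" using y by (simp add: power_divide add_divide_distrib)
    then have "0 + inverse (1 + (t / y)\<^sup>2) * (1 / y) / pi = y / (pi * (y\<^sup>2 + t\<^sup>2))"
      using y by (simp add: divide_simps) (simp add: power2_eq_square)
    moreover have "(g has_field_derivative 0 + inverse (1 + (t / y)\<^sup>2) * (1 / y) / pi) (at t within UNIV)"
      unfolding g_def
      by (intro DERIV_add DERIV_const DERIV_cdivide DERIV_chain2[OF DERIV_arctan] DERIV_ident)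
    ultimately show ?thesis by simp
  qed
  have inj: "inj_on g UNIV" using y by (auto simp: inj_on_def g_def arctan_eq_iff)
  have img: "g ` UNIV = {0<..<1}"
  proof (intro equalityI subsetI)
    fix x assume "x \<in> g ` UNIV"
    then obtain t where "x = g t" by blast
    moreover have "- (1 / 2) < arctan (t / y) / pi" "arctan (t / y) / pi < 1 / 2"
      using arctan_bounded[of "t / y"] by (simp_all add: field_simps)
    ultimately show "x \<in> {0<..<1}" unfolding g_def greaterThanLessThan_iff by linarith
  next
    fix x :: real assume x: "x \<in> {0<..<1}"
    have "arctan (tan (pi * (x - 1 / 2))) = pi * (x - 1 / 2)"
      using x by (intro arctan_tan) (auto simp: field_simps)
    then have "g (y * tan (pi * (x - 1 / 2))) = x" using y by (simp add: g_def)
    then show "x \<in> g ` UNIV" by (metis rangeI)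
  qed
  have "(\<lambda>t. \<bar>y / (pi * (y\<^sup>2 + t\<^sup>2))\<bar> * L (g t)) absolutely_integrable_on UNIV \<and>
      integral UNIV (\<lambda>t. \<bar>y / (pi * (y\<^sup>2 + t\<^sup>2))\<bar> * L (g t)) = ln (norm (F (\<i> * y)))"
    using has_absolute_integral_change_of_variables_1'[OF _ der inj, of L] L2 L3 unfolding img by simp
  moreover have "(\<lambda>t. \<bar>y / (pi * (y\<^sup>2 + t\<^sup>2))\<bar> * L (g t)) = (\<lambda>t. y / (pi * (y\<^sup>2 + t\<^sup>2)) * ln (norm (F t)))"
    using y by (simp add: L_def cg fun_eq_iff)
  ultimately show "(\<lambda>t::real. y / (pi * (y\<^sup>2 + t\<^sup>2)) * ln (norm (F t))) absolutely_integrable_on UNIV"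
    "integral UNIV (\<lambda>t::real. y / (pi * (y\<^sup>2 + t\<^sup>2)) * ln (norm (F t))) = ln (norm (F (\<i> * y)))"
    by (simp_all only:)
qed

section \<open>Polynomial approximation in L^2\<close>

lemma finite_measure_lebesgue_on_Icc: "finite_measure (lebesgue_on {u..v::real})"
  by (rule finite_measure_lebesgue_on) simp

text \<open>A measurable function is almost everywhere a limit of continuous functions. The bound
  \<open>k\<close> allows these to be made uniformly bounded, and dominated convergence then gives
  convergence in L^2.\<close>

lemma L2_continuous_approximation_bounded:
  fixes b :: "real \<Rightarrow> complex"
  assumes b: "b \<in> borel_measurable (lebesgue_on {u..v})" and k: "\<And>r. cmod (b r) \<le> k" and e: "e > 0"
  obtains g where "continuous_on UNIV g" "integrable (lebesgue_on {u..v}) (\<lambda>r. (cmod (b r - g r))\<^sup>2)"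
    "(LINT r|lebesgue_on {u..v}. (cmod (b r - g r))\<^sup>2) < e"
proof -
  let ?M = "lebesgue_on {u..v}"
  interpret finite_measure ?M by (rule finite_measure_lebesgue_on_Icc)
  define b0 where "b0 r = (if r \<in> {u..v} then b r else 0)" for r
  have k0: "k \<ge> 0" using k[of 0] norm_ge_zero order_trans by blast
  have "b0 \<in> borel_measurable lebesgue"
    unfolding b0_def using b by (subst borel_measurable_if) auto
  then have "b0 measurable_on UNIV" by (rule lebesgue_measurable_imp_measurable_on) simp
  then obtain N h where N: "negligible N" and h: "\<And>n. continuous_on UNIV (h n)"
    and lim: "\<And>r. r \<notin> N \<Longrightarrow> (\<lambda>n. h n r) \<longlonglongrightarrow> b0 r"
    unfolding measurable_on_def by auto
  \<comment> \<open>Nearest-point projection onto the disc of radius \<open>k\<close>: it truncates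
    the approximants without losing continuity and fixes the values of \<open>b\<close>.\<close>
  define P where "P = closest_point (cball 0 k :: complex set)"
  have P: "continuous_on UNIV P" "norm (P z) \<le> k" "norm z \<le> k \<Longrightarrow> P z = z" for z
  proof -
    show "continuous_on UNIV P" unfolding P_def using k0 by (intro continuous_on_closest_point) auto
    show "norm (P z) \<le> k" using closest_point_in_set[of "cball 0 k" z] k0 by (auto simp: P_def)
    show "norm z \<le> k \<Longrightarrow> P z = z" unfolding P_def by (intro closest_point_self) auto
  qed
  define g where "g n r = P (h n r)" for n r
  have gc: "continuous_on UNIV (g n)" for n
    unfolding g_def by (rule continuous_on_compose2[OF P(1) h]) auto
  have gm: "g n \<in> borel_measurable ?M" for n
    by (intro continuous_imp_measurable_on_sets_lebesgue continuous_on_subset[OF gc]) auto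
  have m: "(\<lambda>r. (cmod (b r - g n r))\<^sup>2) \<in> borel_measurable ?M" for n
    using b gm[of n] by measurable
  have bd: "norm ((cmod (b r - g n r))\<^sup>2) \<le> (2 * k)\<^sup>2" for n r
  proof -
    have "cmod (b r - g n r) \<le> 2 * k"
      using norm_triangle_ineq4[of "b r" "g n r"] k[of r] P(2)[of "h n r"] by (simp add: g_def)
    then have "(cmod (b r - g n r))\<^sup>2 \<le> (2 * k)\<^sup>2" by (rule power_mono) simp
    then show ?thesis by simp
  qed
  have int: "integrable ?M (\<lambda>r. (cmod (b r - g n r))\<^sup>2)" for n
    by (rule integrable_const_bound[OF _ m]) (use bd in auto)
  have AE: "AE r in ?M. (\<lambda>n. (cmod (b r - g n r))\<^sup>2) \<longlonglongrightarrow> 0"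
  proof -
    have "AE r in lebesgue. r \<notin> N" using N by (simp add: negligible_iff_null_sets AE_not_in)
    then have "AE r in lebesgue. r \<in> {u..v} \<longrightarrow> (\<lambda>n. (cmod (b r - g n r))\<^sup>2) \<longlonglongrightarrow> 0"
    proof eventually_elim
      case (elim r)
      show ?case
      proof
        assume r: "r \<in> {u..v}"
        have "(\<lambda>n. P (h n r)) \<longlonglongrightarrow> P (b0 r)"
          using P(1) lim[OF elim] by (intro continuous_on_tendsto_compose[OF P(1)]) auto
        then have "(\<lambda>n. g n r) \<longlonglongrightarrow> b r" using r P(3)[OF k] by (simp add: g_def b0_def)
        then have "(\<lambda>n. (cmod (b r - g n r))\<^sup>2) \<longlonglongrightarrow> (cmod (b r - b r))\<^sup>2" by (intro tendsto_intros)
        then show "(\<lambda>n. (cmod (b r - g n r))\<^sup>2) \<longlonglongrightarrow> 0" by simp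
      qed
    qed
    then show ?thesis by (subst AE_restrict_space_iff) auto
  qed
  have "(\<lambda>n. LINT r|?M. (cmod (b r - g n r))\<^sup>2) \<longlonglongrightarrow> (LINT r|?M. 0)"
    by (rule integral_dominated_convergence[where w = "\<lambda>_. (2 * k)\<^sup>2"]) (use m AE bd in auto)
  then have "\<forall>\<^sub>F n in sequentially. (LINT r|?M. (cmod (b r - g n r))\<^sup>2) < e"
    using e by (intro order_tendstoD) auto
  then obtain n where "(LINT r|?M. (cmod (b r - g n r))\<^sup>2) < e"
    by (auto simp: eventually_sequentially)
  then show ?thesis using that gc int by blast
qed

lemma norm_diff_square_le:
  fixes x y z :: "'a::real_normed_vector"
  shows "(norm (x - z))\<^sup>2 \<le> 2 * (norm (x - y))\<^sup>2 + 2 * (norm (y - z))\<^sup>2"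
proof -
  have "(norm (x - z))\<^sup>2 \<le> (norm (x - y) + norm (y - z))\<^sup>2"
    by (intro power_mono norm_diff_triangle_le) auto
  also have "\<dots> \<le> 2 * (norm (x - y))\<^sup>2 + 2 * (norm (y - z))\<^sup>2"
    using sum_squares_bound[of "norm (x - y)" "norm (y - z)"] by (simp add: power2_sum)
  finally show ?thesis .
qed

text \<open>A triangle inequality for squared L^2 distances: each link costs a factor 2, in exchange
  for avoiding square roots.\<close>

lemma L2_approximation_trans:
  fixes a b c :: "real \<Rightarrow> complex"
  assumes "integrable M (\<lambda>r. (cmod (a r - b r))\<^sup>2)" "integrable M (\<lambda>r. (cmod (b r - c r))\<^sup>2)"
    and m: "(\<lambda>r. (cmod (a r - c r))\<^sup>2) \<in> borel_measurable M"
  shows "integrable M (\<lambda>r. (cmod (a r - c r))\<^sup>2)"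
    "(LINT r|M. (cmod (a r - c r))\<^sup>2) \<le> 2 * (LINT r|M. (cmod (a r - b r))\<^sup>2) + 2 * (LINT r|M. (cmod (b r - c r))\<^sup>2)"
proof -
  have i: "integrable M (\<lambda>r. 2 * (cmod (a r - b r))\<^sup>2 + 2 * (cmod (b r - c r))\<^sup>2)"
    using assms by (intro Bochner_Integration.integrable_add integrable_mult_right)
  then show i2: "integrable M (\<lambda>r. (cmod (a r - c r))\<^sup>2)"
    by (rule Bochner_Integration.integrable_bound[OF _ m]) (use norm_diff_square_le[of "a _" "c _" "b _"] in \<open>auto intro!: AE_I2\<close>)
  have "(LINT r|M. (cmod (a r - c r))\<^sup>2) \<le> (LINT r|M. 2 * (cmod (a r - b r))\<^sup>2 + 2 * (cmod (b r - c r))\<^sup>2)"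
    using norm_diff_square_le by (intro integral_mono i i2)
  then show "(LINT r|M. (cmod (a r - c r))\<^sup>2) \<le> 2 * (LINT r|M. (cmod (a r - b r))\<^sup>2) + 2 * (LINT r|M. (cmod (b r - c r))\<^sup>2)"
    using assms by simp
qed

text \<open>Truncation, then continuous approximation, then Weierstrass. Polynomials are the target
  because the later estimate integrates by parts against the approximant and bounds its
  derivative.\<close>

theorem L2_polynomial_approximation:
  fixes a :: "real \<Rightarrow> complex"
  assumes a: "a \<in> borel_measurable (lebesgue_on {u..v})"
    and int: "integrable (lebesgue_on {u..v}) (\<lambda>r. (cmod (a r))\<^sup>2)" and e: "e > 0"
  obtains \<phi> where "polynomial_function \<phi>" "integrable (lebesgue_on {u..v}) (\<lambda>r. (cmod (a r - \<phi> r))\<^sup>2)"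
    "(LINT r|lebesgue_on {u..v}. (cmod (a r - \<phi> r))\<^sup>2) < e"
proof -
  let ?M = "lebesgue_on {u..v}"
  interpret finite_measure ?M by (rule finite_measure_lebesgue_on_Icc)
  define b where "b k r = (if cmod (a r) \<le> real k then a r else 0)" for k r
  have bm: "b k \<in> borel_measurable ?M" for k unfolding b_def using a by measurable
  have m: "(\<lambda>r. (cmod (a r - b k r))\<^sup>2) \<in> borel_measurable ?M" for k
    using a bm[of k] by measurable
  have le: "norm ((cmod (a r - b k r))\<^sup>2) \<le> (cmod (a r))\<^sup>2" for k r by (simp add: b_def)
  have i1: "integrable ?M (\<lambda>r. (cmod (a r - b k r))\<^sup>2)" for k
    by (rule Bochner_Integration.integrable_bound[OF int m]) (use le in auto)
  have lim: "(\<lambda>k. (cmod (a r - b k r))\<^sup>2) \<longlonglongrightarrow> 0" for r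
  proof (rule tendsto_eventually)
    obtain k0 where "cmod (a r) \<le> real k0" using real_arch_simple by blast
    then show "\<forall>\<^sub>F k in sequentially. (cmod (a r - b k r))\<^sup>2 = 0"
      by (intro eventually_sequentiallyI[of k0]) (auto simp: b_def)
  qed
  have "(\<lambda>k. LINT r|?M. (cmod (a r - b k r))\<^sup>2) \<longlonglongrightarrow> (LINT r|?M. 0)"
    by (rule integral_dominated_convergence[where w = "\<lambda>r. (cmod (a r))\<^sup>2"]) (use m lim le int in auto)
  then have "\<forall>\<^sub>F k in sequentially. (LINT r|?M. (cmod (a r - b k r))\<^sup>2) < e / 4"
    using e by (intro order_tendstoD) auto
  \<comment> \<open>Two chained squared triangle inequalities weigh the three errors by 2, 4 and 4,
    so e/4, e/16 and e/16 add up to e.\<close>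
  then obtain k where k: "(LINT r|?M. (cmod (a r - b k r))\<^sup>2) < e / 4"
    by (auto simp: eventually_sequentially)
  have "cmod (b k r) \<le> real k" for r by (simp add: b_def)
  then obtain g where g: "continuous_on UNIV g" "integrable ?M (\<lambda>r. (cmod (b k r - g r))\<^sup>2)"
    "(LINT r|?M. (cmod (b k r - g r))\<^sup>2) < e / 16"
    using L2_continuous_approximation_bounded[OF bm, of k k "e / 16"] e by auto
  \<comment> \<open>The \<open>+ 1\<close> keeps \<open>K\<close> positive when the interval has
    measure 0; a uniform error \<open>d\<close> with \<open>d\<^sup>2 * K = e / 16\<close> is what
    Weierstrass has to achieve.\<close>
  define K where "K = measure ?M (space ?M) + 1"
  have K: "K > 0" unfolding K_def by (simp add: add_nonneg_pos)
  define d where "d = sqrt (e / (16 * K))"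
  have d: "d > 0" "d\<^sup>2 = e / (16 * K)" using e K by (auto simp: d_def)
  obtain \<phi> where \<phi>: "polynomial_function \<phi>" "\<And>r. r \<in> {u..v} \<Longrightarrow> cmod (g r - \<phi> r) < d"
    using Stone_Weierstrass_polynomial_function[OF compact_Icc continuous_on_subset[OF g(1)] d(1), of u v] by auto
  have \<phi>m: "\<phi> \<in> borel_measurable ?M" "g \<in> borel_measurable ?M"
    using continuous_on_polymonial_function[OF \<phi>(1)] g(1)
    by (auto intro!: continuous_imp_measurable_on_sets_lebesgue elim: continuous_on_subset)
  have bd: "(cmod (g r - \<phi> r))\<^sup>2 \<le> d\<^sup>2" if "r \<in> {u..v}" for r
    using \<phi>(2)[OF that] by (intro power_mono) auto
  have i3: "integrable ?M (\<lambda>r. (cmod (g r - \<phi> r))\<^sup>2)"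
    by (rule integrable_const_bound[of _ "d\<^sup>2"]) (use bd \<phi>m in \<open>auto intro!: AE_I2\<close>)
  have "(LINT r|?M. (cmod (g r - \<phi> r))\<^sup>2) \<le> (LINT r|?M. d\<^sup>2)"
    using bd by (intro integral_mono i3) auto
  also have "\<dots> \<le> d\<^sup>2 * K" by (simp add: K_def algebra_simps)
  also have "\<dots> = e / 16" using K d by simp
  finally have s3: "(LINT r|?M. (cmod (g r - \<phi> r))\<^sup>2) \<le> e / 16" .
  have mb: "(\<lambda>r. (cmod (b k r - \<phi> r))\<^sup>2) \<in> borel_measurable ?M" "(\<lambda>r. (cmod (a r - \<phi> r))\<^sup>2) \<in> borel_measurable ?M"
    using bm[of k] a \<phi>m by measurable
  note 1 = L2_approximation_trans[OF g(2) i3 mb(1)]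
  note 2 = L2_approximation_trans[OF i1 1(1) mb(2)]
  show ?thesis
    by (rule that[OF \<phi>(1) 2(1)]) (use 1(2) 2(2) k g(3) s3 in linarith)
qed

section \<open>The inequalities of Cauchy-Schwarz and Gronwall\<close>

text \<open>From 2 k F G <= k^2 F^2 + G^2 with a free parameter k > 0; the optimal choice is
  |integral of h| divided by the integral of F^2. Only a pointwise bound by F G is required, so
  integrability of the product F G is never at issue.\<close>

lemma integral_Cauchy_Schwarz:
  fixes h :: "real \<Rightarrow> 'a::euclidean_space"
  assumes h: "h integrable_on S" and F: "(\<lambda>s. (F s)\<^sup>2) integrable_on S" and G: "(\<lambda>s. (G s)\<^sup>2) integrable_on S"
    and le: "\<And>s. s \<in> S \<Longrightarrow> norm (h s) \<le> F s * G s"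
  shows "(norm (integral S h))\<^sup>2 \<le> integral S (\<lambda>s. (F s)\<^sup>2) * integral S (\<lambda>s. (G s)\<^sup>2)"
proof -
  let ?I = "norm (integral S h)" and ?A = "integral S (\<lambda>s. (F s)\<^sup>2)" and ?B = "integral S (\<lambda>s. (G s)\<^sup>2)"
  have A: "?A \<ge> 0" by (rule integral_nonneg[OF F]) simp
  have key: "2 * k * ?I \<le> k\<^sup>2 * ?A + ?B" if k: "k > 0" for k
  proof -
    have i: "(\<lambda>s. (k\<^sup>2 * (F s)\<^sup>2 + (G s)\<^sup>2) / (2 * k)) integrable_on S"
      by (intro integrable_on_divide integrable_add integrable_on_mult_right F G)
    have "?I \<le> integral S (\<lambda>s. (k\<^sup>2 * (F s)\<^sup>2 + (G s)\<^sup>2) / (2 * k))"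
    proof (rule integral_norm_bound_integral[OF h i])
      fix s assume s: "s \<in> S"
      have "F s * G s \<le> (k\<^sup>2 * (F s)\<^sup>2 + (G s)\<^sup>2) / (2 * k)"
        using sum_squares_bound[of "k * F s" "G s"] k by (simp add: field_simps power_mult_distrib)
      then show "norm (h s) \<le> (k\<^sup>2 * (F s)\<^sup>2 + (G s)\<^sup>2) / (2 * k)" using le[OF s] by linarith
    qed
    also have "\<dots> = (k\<^sup>2 * ?A + ?B) / (2 * k)"
      using F G by (simp add: integral_add integrable_on_mult_right integral_divide)
    finally show ?thesis using k by (simp add: field_simps)
  qed
  show ?thesis
  proof (cases "?A = 0")
    case True
    have "?I = 0"
    proof (rule ccontr)
      assume I: "?I \<noteq> 0"
      then have I: "?I > 0" by simp
      have B: "?B \<ge> 0" by (rule integral_nonneg[OF G]) simp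
      \<comment> \<open>If F^2 has integral 0, then k is unrestricted; this value of k turns
        \<open>key\<close> into \<open>?B + 1 \<le> ?B\<close>.\<close>
      have "2 * ((?B + 1) / (2 * ?I)) * ?I \<le> ?B"
        using key[of "(?B + 1) / (2 * ?I)"] True I B by (simp add: add_nonneg_pos)
      then show False using I by simp
    qed
    then show ?thesis using True by simp
  next
    case False
    then have A: "?A > 0" using A by simp
    show ?thesis
    proof (cases "?I = 0")
      case True
      then show ?thesis using A integral_nonneg[OF G] by simp
    next
      case False
      then have "2 * (?I / ?A) * ?I \<le> (?I / ?A)\<^sup>2 * ?A + ?B" using A by (intro key) simp
      then have "?I\<^sup>2 / ?A \<le> ?B" using A by (simp add: power2_eq_square)
      then show ?thesis using A by (simp add: field_simps)
    qed
  qed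
qed

text \<open>The right-hand side \<open>U\<close> is differentiable although \<open>u\<close> is only
  continuous, and U' = B u <= B U makes U exp(-B r) nonincreasing.\<close>

lemma gronwall_const:
  fixes u :: "real \<Rightarrow> real"
  assumes u: "continuous_on {0..R} u" and B: "B \<ge> 0"
    and le: "\<And>r. r \<in> {0..R} \<Longrightarrow> u r \<le> A + B * integral {0..r} u"
    and r: "r \<in> {0..R}"
  shows "u r \<le> A * exp (B * r)"
proof -
  define U where "U r = A + B * integral {0..r} u" for r
  define W where "W r = U r * exp (- B * r)" for r
  have U': "(U has_real_derivative B * u s) (at s within {0..r})" if "s \<in> {0..r}" for s
  proof -
    have "((\<lambda>x. integral {0..x} u) has_real_derivative u s) (at s within {0..R})"
      using integral_has_real_derivative[OF u] that r by auto
    then have "((\<lambda>x. integral {0..x} u) has_real_derivative u s) (at s within {0..r})"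
      by (rule has_field_derivative_subset) (use r in auto)
    then show ?thesis unfolding U_def by (auto intro!: derivative_eq_intros)
  qed
  have W': "(W has_vector_derivative (B * u s - B * U s) * exp (- B * s)) (at s within {0..r})" if "s \<in> {0..r}" for s
    unfolding W_def has_real_derivative_iff_has_vector_derivative[symmetric]
    by (rule derivative_eq_intros U'[OF that] refl | simp add: algebra_simps)+
  have "((\<lambda>s. (B * u s - B * U s) * exp (- B * s)) has_integral (W r - W 0)) {0..r}"
    using r by (intro fundamental_theorem_of_calculus W') auto
  then have "W r - W 0 \<le> 0"
  proof (rule has_integral_le[OF _ has_integral_0])
    fix s assume s: "s \<in> {0..r}"
    have "u s \<le> U s" using le[of s] s r by (simp add: U_def)
    then have "B * u s - B * U s \<le> 0" using B by (simp add: mult_left_mono)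
    then show "(B * u s - B * U s) * exp (- B * s) \<le> 0" by (simp add: mult_nonpos_nonneg)
  qed
  then have "U r * exp (- B * r) \<le> A" by (simp add: W_def U_def)
  then have "U r \<le> A * exp (B * r)" by (simp add: exp_minus field_simps)
  then show ?thesis using le[OF r] by (simp add: U_def)
qed

section \<open>Columns of the Krein system and their conserved forms\<close>

text \<open>A single column of the matrix equation; initial values are left out so that both columns
  satisfy the same predicate.\<close>

definition krein_pair :: "real \<Rightarrow> (real \<Rightarrow> complex) \<Rightarrow> complex \<Rightarrow> (real \<Rightarrow> complex) \<Rightarrow> (real \<Rightarrow> complex) \<Rightarrow> bool" where
  "krein_pair R a z p q \<longleftrightarrow>
     ac_deriv R p (\<lambda>r. \<i> * z * p r - cnj (a r) * q r) \<and> ac_deriv R q (\<lambda>r. - a r * p r)"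

lemma krein_solution_column:
  assumes "krein_solution R a z X"
  shows "krein_pair R a z (\<lambda>r. vec_nth (vec_nth (X r) 1) j) (\<lambda>r. vec_nth (vec_nth (X r) 2) j)"
proof -
  have X: "ac_deriv R X (\<lambda>r. krein_matrix (a r) z ** X r)"
    using assms by (simp add: krein_solution_def ac_deriv_def)
  have lin: "bounded_linear (\<lambda>Y::complex^2^2. vec_nth (vec_nth Y i) j)" for i
    by (rule bounded_linear_compose[OF bounded_linear_vec_nth bounded_linear_vec_nth])
  have "ac_deriv R (\<lambda>r. vec_nth (vec_nth (X r) i) j) (\<lambda>r. vec_nth (vec_nth (krein_matrix (a r) z ** X r) i) j)" for i
    by (rule ac_deriv_linear[OF lin X])
  from this[of 1] this[of 2] show ?thesis
    unfolding krein_pair_def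
    by (simp add: krein_matrix_def matrix_matrix_mult_def sum_2 vector_2)
qed

text \<open>In the derivative of q1 p2 - p1 q2 all terms with \<open>a\<close> cancel. The factor
  exp(-\<i> w s), the reciprocal of det X(s, w), cancels the remaining part for z = w, which leaves
  a multiple of z - w.\<close>

lemma krein_wronskian:
  assumes "krein_pair R a w p1 q1" "krein_pair R a z p2 q2"
  shows "ac_deriv R (\<lambda>s. exp (- \<i> * w * s) * (q1 s * p2 s - p1 s * q2 s))
     (\<lambda>s. \<i> * (z - w) * (exp (- \<i> * w * s) * q1 s * p2 s))"
proof -
  have e: "ac_deriv R (\<lambda>s. exp (- \<i> * w * of_real s)) (\<lambda>s. - \<i> * w * exp (- \<i> * w * of_real s))"
  proof (rule ac_deriv_smooth)
    show "((\<lambda>s. exp (- \<i> * w * of_real s)) has_vector_derivative - \<i> * w * exp (- \<i> * w * of_real r)) (at r)" for r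
      by (rule has_vector_derivative_real_field) (auto intro!: derivative_eq_intros)
  qed (auto intro!: continuous_intros)
  note d1 = conjunct1[OF assms(1)[unfolded krein_pair_def]] conjunct2[OF assms(1)[unfolded krein_pair_def]]
  note d2 = conjunct1[OF assms(2)[unfolded krein_pair_def]] conjunct2[OF assms(2)[unfolded krein_pair_def]]
  show ?thesis
    by (rule ac_deriv_cong[OF ac_deriv_mult[OF e ac_deriv_diff[OF ac_deriv_mult[OF d1(2) d2(1)] ac_deriv_mult[OF d1(1) d2(2)]]]])
       (simp add: algebra_simps)
qed

text \<open>The coefficient \<open>a\<close> drops out because its part of the system is skew for
  the indefinite form diag(1, -1); the diagonal entry contributes only through Im z. With two
  different solutions it also yields the orthogonality of the columns for real z.\<close>

lemma krein_energy:
  assumes "krein_pair R a z p1 q1" "krein_pair R a z p2 q2"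
  shows "ac_deriv R (\<lambda>s. cnj (p1 s) * p2 s - cnj (q1 s) * q2 s) (\<lambda>s. - 2 * Im z * (cnj (p1 s) * p2 s))"
proof -
  note d1 = conjunct1[OF assms(1)[unfolded krein_pair_def]] conjunct2[OF assms(1)[unfolded krein_pair_def]]
  note d2 = conjunct1[OF assms(2)[unfolded krein_pair_def]] conjunct2[OF assms(2)[unfolded krein_pair_def]]
  have z: "\<i> * z - \<i> * cnj z = - 2 * Im z" by (simp add: complex_eq_iff)
  have "ac_deriv R (\<lambda>s. cnj (p1 s) * p2 s - cnj (q1 s) * q2 s) (\<lambda>s. (\<i> * z - \<i> * cnj z) * (cnj (p1 s) * p2 s))"
    by (rule ac_deriv_cong[OF ac_deriv_diff[OF ac_deriv_mult[OF ac_deriv_cnj[OF d1(1)] d2(1)] ac_deriv_mult[OF ac_deriv_cnj[OF d1(2)] d2(2)]]])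
       (simp add: algebra_simps)
  then show ?thesis unfolding z .
qed

text \<open>\<open>(\<alpha>, \<beta>)\<close> and \<open>(p, q)\<close> are the columns of the fundamental matrix, so \<open>q\<close> and \<open>\<beta>\<close> are the Wall
  polynomials of the paper.\<close>

locale krein_system =
  fixes R :: real and a :: "real \<Rightarrow> complex" and \<alpha> \<beta> p q :: "complex \<Rightarrow> real \<Rightarrow> complex"
  assumes R: "R > 0"
    and a_meas: "a \<in> borel_measurable (lebesgue_on {0..R})"
    and a_L2: "integrable (lebesgue_on {0..R}) (\<lambda>r. (cmod (a r))\<^sup>2)"
    and col1: "\<And>z. krein_pair R a z (\<alpha> z) (\<beta> z)" and col1_0: "\<And>z. \<alpha> z 0 = 1" "\<And>z. \<beta> z 0 = 0"
    and col2: "\<And>z. krein_pair R a z (p z) (q z)" and col2_0: "\<And>z. p z 0 = 0" "\<And>z. q z 0 = 1"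
begin

section \<open>Bounds in the closed upper half-plane and variation of constants\<close>

definition c :: real where "c = integral {0..R} (\<lambda>r. (cmod (a r))\<^sup>2)"

lemma a_sq_integrable: "r \<in> {0..R} \<Longrightarrow> (\<lambda>r. (cmod (a r))\<^sup>2) integrable_on {0..r}"
  using integrable_on_lebesgue_on[OF a_L2] by (rule integrable_on_subinterval) auto

lemma a_sq_integral_le: "r \<in> {0..R} \<Longrightarrow> integral {0..r} (\<lambda>r. (cmod (a r))\<^sup>2) \<le> c"
  unfolding c_def using R by (intro integral_subset_le a_sq_integrable) auto

lemma c_nonneg: "c \<ge> 0"
  unfolding c_def using R by (intro integral_nonneg a_sq_integrable) auto

lemma continuous_entries:
  "continuous_on {0..R} (\<alpha> z)" "continuous_on {0..R} (\<beta> z)" "continuous_on {0..R} (p z)" "continuous_on {0..R} (q z)"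
  using col1[of z] col2[of z] unfolding krein_pair_def by (auto intro: ac_deriv_continuous)

lemma p_sq_integrable: "r \<in> {0..R} \<Longrightarrow> (\<lambda>s. (cmod (p z s))\<^sup>2) integrable_on {0..r}"
  by (intro integrable_continuous_interval continuous_intros continuous_on_subset[OF continuous_entries(3)]) auto

lemma p_sq_integral_nonneg: "r \<in> {0..R} \<Longrightarrow> integral {0..r} (\<lambda>s. (cmod (p z s))\<^sup>2) \<ge> 0"
  by (intro integral_nonneg p_sq_integrable) auto

lemma has_integral_q: "r \<in> {0..R} \<Longrightarrow> ((\<lambda>s. - a s * p z s) has_integral q z r - 1) {0..r}"
  using ac_deriv_has_integral[OF ac_deriv_subinterval[OF conjunct2[OF col2[of z, unfolded krein_pair_def]]], of r]
  by (simp add: col2_0)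

lemma energy_identity:
  assumes r: "r \<in> {0..R}"
  shows "(cmod (q z r))\<^sup>2 = 1 + (cmod (p z r))\<^sup>2 + 2 * Im z * integral {0..r} (\<lambda>s. (cmod (p z s))\<^sup>2)"
proof -
  have n: "cnj u * u = of_real ((cmod u)\<^sup>2)" for u
    by (simp only: complex_norm_square mult.commute)
  have "((\<lambda>s. - 2 * Im z * (cnj (p z s) * p z s)) has_integral
      (cnj (p z r) * p z r - cnj (q z r) * q z r + 1)) {0..r}"
    using ac_deriv_has_integral[OF ac_deriv_subinterval[OF krein_energy[OF col2[of z] col2[of z]]], of r] r
    by (simp add: col2_0)
  from has_integral_Re[OF this]
  have "((\<lambda>s. (- 2 * Im z) * (cmod (p z s))\<^sup>2) has_integral (cmod (p z r))\<^sup>2 - (cmod (q z r))\<^sup>2 + 1) {0..r}"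
    unfolding n by (simp flip: of_real_power)
  moreover have "((\<lambda>s. (- 2 * Im z) * (cmod (p z s))\<^sup>2) has_integral
      (- 2 * Im z) * integral {0..r} (\<lambda>s. (cmod (p z s))\<^sup>2)) {0..r}"
    using r by (intro has_integral_mult_right integrable_integral p_sq_integrable)
  ultimately have "(cmod (p z r))\<^sup>2 - (cmod (q z r))\<^sup>2 + 1 = (- 2 * Im z) * integral {0..r} (\<lambda>s. (cmod (p z s))\<^sup>2)"
    by (rule has_integral_unique)
  then show ?thesis by simp
qed

lemma norm_q_ge:
  assumes r: "r \<in> {0..R}" and z: "Im z \<ge> 0"
  shows "1 \<le> cmod (q z r)" "cmod (p z r) \<le> cmod (q z r)"
proof -
  have "0 \<le> 2 * Im z * integral {0..r} (\<lambda>s. (cmod (p z s))\<^sup>2)"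
    using z p_sq_integral_nonneg[OF r] by simp
  then have "1\<^sup>2 \<le> (cmod (q z r))\<^sup>2" "(cmod (p z r))\<^sup>2 \<le> (cmod (q z r))\<^sup>2"
    using energy_identity[OF r, of z] by (simp_all add: add_increasing2)
  then show "1 \<le> cmod (q z r)" "cmod (p z r) \<le> cmod (q z r)"
    using power2_le_imp_le norm_ge_zero by blast+
qed

text \<open>Cauchy-Schwarz applied to q - 1 = - int a p moves all of \<open>a\<close> into the
  constant \<open>c\<close>, so that Gronwall's inequality can be used with no pointwise bound on
  \<open>a\<close>.\<close>

lemma norm_q_minus_one_sq:
  assumes r: "r \<in> {0..R}"
  shows "(cmod (q z r - 1))\<^sup>2 \<le> c * integral {0..r} (\<lambda>s. (cmod (p z s))\<^sup>2)"
proof -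
  have "(norm (integral {0..r} (\<lambda>s. - a s * p z s)))\<^sup>2 \<le>
      integral {0..r} (\<lambda>s. (cmod (a s))\<^sup>2) * integral {0..r} (\<lambda>s. (cmod (p z s))\<^sup>2)"
    using r by (intro integral_Cauchy_Schwarz a_sq_integrable p_sq_integrable has_integral_integrable[OF has_integral_q])
      (auto simp: norm_mult)
  also have "\<dots> \<le> c * integral {0..r} (\<lambda>s. (cmod (p z s))\<^sup>2)"
    by (intro mult_right_mono a_sq_integral_le p_sq_integral_nonneg r)
  finally show ?thesis unfolding integral_unique[OF has_integral_q[OF r]] .
qed

text \<open>A bound for |q|^2, not for |q|. The initial value 2 and the rate 2 c both stem from
  |q|^2 <= 2 |q - 1|^2 + 2.\<close>

definition K :: real where "K = 2 * exp (2 * c * R)"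

lemma K_pos: "K > 0" by (simp add: K_def)

text \<open>Since |p| <= |q| when Im z >= 0, the estimate of |q - 1|^2 by int |p|^2 closes up into a
  Gronwall inequality for |q|^2 alone, with constants that do not involve z.\<close>

lemma norm_q_sq_le:
  assumes r: "r \<in> {0..R}" and z: "Im z \<ge> 0"
  shows "(cmod (q z r))\<^sup>2 \<le> K"
proof -
  have "(cmod (q z r))\<^sup>2 \<le> 2 * exp (2 * c * r)"
  proof (rule gronwall_const[OF _ _ _ r])
    show c: "continuous_on {0..R} (\<lambda>r. (cmod (q z r))\<^sup>2)"
      by (intro continuous_intros continuous_entries)
    show "2 * c \<ge> 0" using c_nonneg by simp
    fix s assume s: "s \<in> {0..R}"
    have "(cmod (q z s))\<^sup>2 \<le> 2 * (cmod (q z s - 1))\<^sup>2 + 2"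
      using norm_diff_square_le[of "q z s" 0 1] by simp
    also have "(cmod (q z s - 1))\<^sup>2 \<le> c * integral {0..s} (\<lambda>s. (cmod (p z s))\<^sup>2)"
      by (rule norm_q_minus_one_sq[OF s])
    also have "\<dots> \<le> c * integral {0..s} (\<lambda>s. (cmod (q z s))\<^sup>2)"
      using s norm_q_ge(2)[OF _ z] c_nonneg
      by (intro mult_left_mono integral_le p_sq_integrable integrable_continuous_interval continuous_on_subset[OF c] power_mono) auto
    finally show "(cmod (q z s))\<^sup>2 \<le> 2 + 2 * c * integral {0..s} (\<lambda>r. (cmod (q z r))\<^sup>2)" by simp
  qed
  also have "\<dots> \<le> K" unfolding K_def using r c_nonneg by (simp add: mult_left_mono)
  finally show ?thesis .
qed

lemma norm_q_le: "r \<in> {0..R} \<Longrightarrow> Im z \<ge> 0 \<Longrightarrow> cmod (q z r) \<le> sqrt K"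
  using norm_q_sq_le real_le_rsqrt by blast

lemma norm_p_le: "r \<in> {0..R} \<Longrightarrow> Im z \<ge> 0 \<Longrightarrow> cmod (p z r) \<le> sqrt K"
  using norm_q_le norm_q_ge(2) order_trans by blast

text \<open>The kernels are, up to sign, the first column of \<open>X(s, w)\<^sup>-\<^sup>1\<close>, because
  \<open>det X(s, w) = exp (\<i> w s)\<close>; integrating the derivative of \<open>X(s, w)\<^sup>-\<^sup>1 X(s, z)\<close> gives
  \<open>X(r, z) - X(r, w)\<close>.\<close>

definition duhamel :: "(complex \<Rightarrow> real \<Rightarrow> complex) \<Rightarrow> (complex \<Rightarrow> real \<Rightarrow> complex) \<Rightarrow> complex \<Rightarrow> real \<Rightarrow> (real \<Rightarrow> complex) \<Rightarrow> complex" where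
  "duhamel x y w r f =
     x w r * integral {0..r} (\<lambda>s. exp (- \<i> * w * s) * q w s * f s)
     - y w r * integral {0..r} (\<lambda>s. exp (- \<i> * w * s) * \<beta> w s * f s)"

lemma variation_of_constants:
  fixes w z :: complex
  assumes r: "r \<in> {0..R}"
  shows "p z r - p w r = \<i> * (z - w) * duhamel \<alpha> p w r (p z)"
    "q z r - q w r = \<i> * (z - w) * duhamel \<beta> q w r (p z)"
proof -
  define U where "U = integral {0..r} (\<lambda>s. exp (- \<i> * w * s) * q w s * p z s)"
  define V where "V = integral {0..r} (\<lambda>s. exp (- \<i> * w * s) * \<beta> w s * p z s)"
  have r0: "0 \<le> r" "r \<le> R" using r by auto
  define E where "E = exp (- \<i> * w * r)"
  have E: "E \<noteq> 0" by (simp add: E_def)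
  have cont: "(\<lambda>s. exp (- \<i> * w * of_real s) * q w s * p z s) integrable_on {0..r}"
    "(\<lambda>s. exp (- \<i> * w * of_real s) * \<beta> w s * p z s) integrable_on {0..r}"
    using r by (auto intro!: integrable_continuous_interval continuous_intros
        continuous_on_subset[OF continuous_entries(2)] continuous_on_subset[OF continuous_entries(3)]
        continuous_on_subset[OF continuous_entries(4)])
  have "((\<lambda>s. \<i> * (z - w) * (exp (- \<i> * w * s) * q w s * p z s)) has_integral E * (q w r * p z r - p w r * q z r)) {0..r}"
    using ac_deriv_has_integral[OF ac_deriv_subinterval[OF krein_wronskian[OF col2[of w] col2[of z]] r0(2)] r0(1)]
    by (simp add: col2_0 E_def)
  then have U: "E * (q w r * p z r - p w r * q z r) = \<i> * (z - w) * U"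
    unfolding U_def by (rule has_integral_unique) (intro has_integral_mult_right integrable_integral cont)
  have "((\<lambda>s. \<i> * (z - w) * (exp (- \<i> * w * s) * \<beta> w s * p z s)) has_integral E * (\<beta> w r * p z r - \<alpha> w r * q z r) + 1) {0..r}"
    using ac_deriv_has_integral[OF ac_deriv_subinterval[OF krein_wronskian[OF col1[of w] col2[of z]] r0(2)] r0(1)]
    by (simp add: col1_0 col2_0 E_def)
  then have V: "E * (\<beta> w r * p z r - \<alpha> w r * q z r) + 1 = \<i> * (z - w) * V"
    unfolding V_def by (rule has_integral_unique) (intro has_integral_mult_right integrable_integral cont)
  \<comment> \<open>The Wronskian of the two columns at \<open>z = w\<close> has derivative 0; this
    is Liouville's formula det X(r, w) = exp(\<i> w r).\<close>
  have "((\<lambda>s. 0) has_integral E * (\<beta> w r * p w r - \<alpha> w r * q w r) + 1) {0..r}"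
    using ac_deriv_has_integral[OF ac_deriv_subinterval[OF krein_wronskian[OF col1[of w] col2[of w]] r0(2)] r0(1)]
    by (simp add: col1_0 col2_0 E_def)
  then have D: "E * (\<alpha> w r * q w r - \<beta> w r * p w r) = 1"
    using has_integral_unique[OF has_integral_0] by (fastforce simp: algebra_simps eq_neg_iff_add_eq_0)
  have "\<i> * (z - w) * (\<alpha> w r * U - p w r * V) = \<alpha> w r * (\<i> * (z - w) * U) - p w r * (\<i> * (z - w) * V)"
    by (simp add: algebra_simps)
  also have "\<dots> = E * (\<alpha> w r * q w r - \<beta> w r * p w r) * p z r - p w r"
    unfolding U[symmetric] V[symmetric] by (simp add: algebra_simps)
  finally show "p z r - p w r = \<i> * (z - w) * duhamel \<alpha> p w r (p z)"
    unfolding D duhamel_def U_def V_def by simp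
  have "\<i> * (z - w) * (\<beta> w r * U - q w r * V) = \<beta> w r * (\<i> * (z - w) * U) - q w r * (\<i> * (z - w) * V)"
    by (simp add: algebra_simps)
  also have "\<dots> = E * (\<alpha> w r * q w r - \<beta> w r * p w r) * q z r - q w r"
    unfolding U[symmetric] V[symmetric] by (simp add: algebra_simps)
  finally show "q z r - q w r = \<i> * (z - w) * duhamel \<beta> q w r (p z)"
    unfolding D duhamel_def U_def V_def by simp
qed

end

section \<open>Dependence on the spectral parameter\<close>

lemma tendsto_of_lipschitz_at:
  fixes f :: "'a::real_normed_vector \<Rightarrow> 'b::real_normed_vector"
  assumes "\<And>z. z \<in> S \<Longrightarrow> norm (f z - f w) \<le> L * norm (z - w)"
  shows "(f \<longlongrightarrow> f w) (at w within S)"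
proof -
  have "((\<lambda>z. L * norm (z - w)) \<longlongrightarrow> L * norm (w - w)) (at w within S)" by (intro tendsto_intros)
  then have lim: "((\<lambda>z. L * norm (z - w)) \<longlongrightarrow> 0) (at w within S)" by simp
  have ev: "\<forall>\<^sub>F z in at w within S. norm (f z - f w) \<le> L * norm (z - w)"
    unfolding eventually_at_filter using assms by (intro always_eventually) blast
  have "((\<lambda>z. f z - f w) \<longlongrightarrow> 0) (at w within S)" by (rule Lim_null_comparison[OF ev lim])
  then show ?thesis by (rule Lim_null[THEN iffD2])
qed

context krein_system
begin

text \<open>The constant may depend on \<open>w\<close>, which stays fixed while z varies, but
  serves all \<open>r\<close> and \<open>f\<close>. With \<open>b\<close> bounding the four entries
  and the exponential on [0, R], each of the two products is at most b^3 M R.\<close>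

lemma duhamel_bound:
  "\<exists>C\<ge>0. \<forall>r\<in>{0..R}. \<forall>f M. continuous_on {0..R} f \<longrightarrow> (\<forall>s\<in>{0..R}. cmod (f s) \<le> M) \<longrightarrow>
      cmod (duhamel \<alpha> p w r f) \<le> C * M \<and> cmod (duhamel \<beta> q w r f) \<le> C * M"
proof -
  have "\<exists>B. \<forall>r\<in>{0..R}. cmod (f r) \<le> B" if "continuous_on {0..R} f" for f :: "real \<Rightarrow> complex"
    using continuous_on_Icc_bounded[OF that] by metis
  note B = this
  obtain B1 where B1: "\<And>r. r \<in> {0..R} \<Longrightarrow> cmod (\<alpha> w r) \<le> B1" using B[OF continuous_entries(1)] by blast
  obtain B2 where B2: "\<And>r. r \<in> {0..R} \<Longrightarrow> cmod (\<beta> w r) \<le> B2" using B[OF continuous_entries(2)] by blast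
  obtain B3 where B3: "\<And>r. r \<in> {0..R} \<Longrightarrow> cmod (p w r) \<le> B3" using B[OF continuous_entries(3)] by blast
  obtain B4 where B4: "\<And>r. r \<in> {0..R} \<Longrightarrow> cmod (q w r) \<le> B4" using B[OF continuous_entries(4)] by blast
  have "continuous_on {0..R} (\<lambda>s. exp (- \<i> * w * of_real s))" by (intro continuous_intros)
  then obtain B5 where B5: "\<And>r. r \<in> {0..R} \<Longrightarrow> cmod (exp (- \<i> * w * of_real r)) \<le> B5" using B by blast
  define b where "b = max B1 (max B2 (max B3 (max B4 B5)))"
  have le: "cmod (\<alpha> w r) \<le> b" "cmod (\<beta> w r) \<le> b" "cmod (p w r) \<le> b" "cmod (q w r) \<le> b"
    "cmod (exp (- \<i> * w * of_real r)) \<le> b" if "r \<in> {0..R}" for r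
    using B1[OF that] B2[OF that] B3[OF that] B4[OF that] B5[OF that]
    by (simp_all add: b_def le_max_iff_disj)
  have b0: "b \<ge> 0" using le(1)[of 0] R order_trans[OF norm_ge_zero] by auto
  have I: "cmod (integral {0..r} (\<lambda>s. exp (- \<i> * w * s) * f s * P s)) \<le> b * b * M * R"
    if r: "r \<in> {0..R}" and P: "continuous_on {0..R} P" "\<And>s. s \<in> {0..R} \<Longrightarrow> cmod (P s) \<le> M"
      and f: "continuous_on {0..R} f" "\<And>s. s \<in> {0..R} \<Longrightarrow> cmod (f s) \<le> b" for r P M f
  proof -
    have M0: "M \<ge> 0" using P(2)[OF r] norm_ge_zero order_trans by blast
    have "cmod (integral {0..r} (\<lambda>s. exp (- \<i> * w * s) * f s * P s)) \<le> b * b * M * (r - 0)"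
      using r le(5) P f b0 unfolding norm_mult
      by (intro integral_bound continuous_intros continuous_on_subset[OF P(1)] continuous_on_subset[OF f(1)])
         (auto simp: norm_mult intro!: mult_mono)
    also have "\<dots> \<le> b * b * M * R" using r b0 M0 by (intro mult_left_mono) auto
    finally show ?thesis .
  qed
  have J: "cmod (x * u - y * v) \<le> (2 * b * b * b * R) * M"
    if "cmod x \<le> b" "cmod y \<le> b" "cmod u \<le> b * b * M * R" "cmod v \<le> b * b * M * R" for x y u v M
  proof -
    have "cmod (x * u - y * v) \<le> cmod x * cmod u + cmod y * cmod v"
      using norm_triangle_ineq4[of "x * u" "y * v"] by (simp add: norm_mult)
    also have "\<dots> \<le> b * (b * b * M * R) + b * (b * b * M * R)"
      using that b0 by (intro add_mono mult_mono) auto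
    finally show ?thesis by (simp add: algebra_simps)
  qed
  show ?thesis
  proof (intro exI[of _ "2 * b * b * b * R"] conjI ballI allI impI)
    show "2 * b * b * b * R \<ge> 0" using b0 R by simp
    fix r f M assume *: "r \<in> {0..R}" "continuous_on {0..R} f" "\<forall>s\<in>{0..R}. cmod (f s) \<le> M"
    note II = I[OF *(1,2) bspec[OF *(3)]]
    show "cmod (duhamel \<alpha> p w r f) \<le> 2 * b * b * b * R * M" "cmod (duhamel \<beta> q w r f) \<le> 2 * b * b * b * R * M"
      unfolding duhamel_def by (intro J II le *(1) continuous_entries; assumption)+
  qed
qed

text \<open>In the variation of constants formula the integrand is \<open>p z\<close>, bounded by
  \<open>sqrt K\<close> uniformly for Im z >= 0, so the factor z - w alone governs the
  difference.\<close>

lemma lipschitz_entries: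
  "\<exists>L\<ge>0. \<forall>z r. Im z \<ge> 0 \<longrightarrow> r \<in> {0..R} \<longrightarrow>
     cmod (p z r - p w r) \<le> L * cmod (z - w) \<and> cmod (q z r - q w r) \<le> L * cmod (z - w)"
proof -
  obtain C where C: "C \<ge> 0"
    "\<And>r f M. r \<in> {0..R} \<Longrightarrow> continuous_on {0..R} f \<Longrightarrow> \<forall>s\<in>{0..R}. cmod (f s) \<le> M \<Longrightarrow>
      cmod (duhamel \<alpha> p w r f) \<le> C * M \<and> cmod (duhamel \<beta> q w r f) \<le> C * M"
    using duhamel_bound[of w] by auto
  show ?thesis
  proof (intro exI[of _ "C * sqrt K"] conjI allI impI)
    show "C * sqrt K \<ge> 0" using C(1) K_pos by simp
    fix z r assume z: "Im z \<ge> 0" and r: "r \<in> {0..R}"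
    have "\<forall>s\<in>{0..R}. cmod (p z s) \<le> sqrt K" using norm_p_le[OF _ z] by simp
    note le = C(2)[OF r continuous_entries(3) this, THEN conjunct1] C(2)[OF r continuous_entries(3) this, THEN conjunct2]
    show "cmod (p z r - p w r) \<le> C * sqrt K * cmod (z - w)"
      unfolding variation_of_constants(1)[OF r, of z w] norm_mult
      using mult_left_mono[OF le(1), of "cmod (z - w)"] by (simp add: mult.commute)
    show "cmod (q z r - q w r) \<le> C * sqrt K * cmod (z - w)"
      unfolding variation_of_constants(2)[OF r, of z w] norm_mult
      using mult_left_mono[OF le(2), of "cmod (z - w)"] by (simp add: mult.commute)
  qed
qed

lemma continuous_on_q: "continuous_on {z. Im z \<ge> 0} (\<lambda>z. q z R)"
  unfolding continuous_on_def
proof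
  fix w assume "w \<in> {z. Im z \<ge> 0}"
  obtain L where L: "L \<ge> 0" "\<And>z r. Im z \<ge> 0 \<Longrightarrow> r \<in> {0..R} \<Longrightarrow> cmod (q z r - q w r) \<le> L * cmod (z - w)"
    using lipschitz_entries[of w] by auto
  show "((\<lambda>z. q z R) \<longlongrightarrow> q w R) (at w within {z. Im z \<ge> 0})"
    by (rule tendsto_of_lipschitz_at[of _ _ _ L]) (use L(2)[of _ R] R in auto)
qed

text \<open>By variation of constants the difference quotient at \<open>w\<close> equals
  \<open>\<i> * G z\<close> exactly. Differentiability therefore reduces to continuity of
  \<open>G\<close> at \<open>w\<close>, which follows from linearity in \<open>p z\<close> and the
  Lipschitz bound, without differentiating under the integral.\<close>

lemma holomorphic_on_q: "(\<lambda>z. q z R) holomorphic_on {z. Im z > 0}"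
  unfolding holomorphic_on_def field_differentiable_def
proof
  let ?S = "{z. Im z > 0}"
  fix w assume w: "w \<in> ?S"
  obtain C where C: "C \<ge> 0"
    "\<And>r f M. r \<in> {0..R} \<Longrightarrow> continuous_on {0..R} f \<Longrightarrow> \<forall>s\<in>{0..R}. cmod (f s) \<le> M \<Longrightarrow>
      cmod (duhamel \<beta> q w r f) \<le> C * M"
    using duhamel_bound[of w] by auto
  obtain L where L: "L \<ge> 0" "\<And>z r. Im z \<ge> 0 \<Longrightarrow> r \<in> {0..R} \<Longrightarrow> cmod (p z r - p w r) \<le> L * cmod (z - w)"
    using lipschitz_entries[of w] by auto
  have RR: "R \<in> {0..R}" using R by simp
  define G where "G z = duhamel \<beta> q w R (p z)" for z
  have cont: "(\<lambda>s. exp (- \<i> * w * of_real s) * q w s * p z s) integrable_on {0..R}"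
    "(\<lambda>s. exp (- \<i> * w * of_real s) * \<beta> w s * p z s) integrable_on {0..R}" for z
    by (auto intro!: integrable_continuous_interval continuous_intros continuous_entries)
  have diff: "duhamel \<beta> q w R (\<lambda>s. p z s - p w s) = G z - G w" for z
    unfolding G_def duhamel_def right_diff_distrib integral_diff[OF cont(1) cont(1)] integral_diff[OF cont(2) cont(2)]
    by simp
  have le: "cmod (G z - G w) \<le> C * (L * cmod (z - w))" if "Im z \<ge> 0" for z
    unfolding diff[symmetric] using L(2)[OF that] by (intro C(2) RR continuous_on_diff continuous_entries) auto
  have "(G \<longlongrightarrow> G w) (at w within ?S)"
    by (rule tendsto_of_lipschitz_at[of _ _ _ "C * L"]) (use le in \<open>auto simp: mult.assoc\<close>)
  then have "continuous (at w within ?S) (\<lambda>z. \<i> * G z)"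
    unfolding continuous_within by (intro tendsto_intros)
  moreover have "q z R - q w R = (\<i> * G z) * (z - w)" for z
    unfolding G_def variation_of_constants(2)[OF RR, of z w] by (simp only: mult.assoc mult.commute[of "z - w"])
  ultimately have "((\<lambda>z. q z R) has_field_derivative \<i> * G w) (at w within ?S)"
    unfolding DERIV_caratheodory_within by (intro exI[of _ "\<lambda>z. \<i> * G z"]) simp
  then show "\<exists>D. ((\<lambda>z. q z R) has_field_derivative D) (at w within ?S)" by blast
qed

lemma poisson_q:
  assumes y: "y > 0"
  shows "integrable lebesgue (\<lambda>t::real. y / (pi * (y\<^sup>2 + t\<^sup>2)) * ln (cmod (q t R)))"
    "(LINT t::real|lebesgue. y / (pi * (y\<^sup>2 + t\<^sup>2)) * ln (cmod (q t R))) = ln (cmod (q (\<i> * y) R))"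
proof -
  have "R \<in> {0..R}" using R by simp
  then have bd: "1 \<le> cmod (q z R) \<and> cmod (q z R) \<le> sqrt K" if "Im z \<ge> 0" for z
    using norm_q_ge(1) norm_q_le that by blast
  note P = poisson_half_plane_ln_norm[OF holomorphic_on_q continuous_on_q bd y]
  show int: "integrable lebesgue (\<lambda>t::real. y / (pi * (y\<^sup>2 + t\<^sup>2)) * ln (cmod (q t R)))"
    using P(1) by (simp add: set_integrable_def)
  show "(LINT t::real|lebesgue. y / (pi * (y\<^sup>2 + t\<^sup>2)) * ln (cmod (q t R))) = ln (cmod (q (\<i> * y) R))"
    using lebesgue_integral_eq_integral[of UNIV "\<lambda>t. y / (pi * (y\<^sup>2 + t\<^sup>2)) * ln (cmod (q t R))"] int P(2)
    by (simp add: lebesgue_on_UNIV_eq)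
qed

section \<open>Asymptotics along the imaginary axis\<close>

text \<open>At z = \<i> y the derivative of |p|^2 contains the damping term -2 y |p|^2. Half of it
  absorbs the forcing term through 2 (y |p|) (|a| |q|) <= (y |p|)^2 + (|a| |q|)^2; the other half
  becomes the integral on the left.\<close>

lemma p_decay:
  assumes y: "y > 0" and r: "r \<in> {0..R}"
  shows "(cmod (p (\<i> * y) r))\<^sup>2 + y * integral {0..r} (\<lambda>s. (cmod (p (\<i> * y) s))\<^sup>2) \<le> K * c / y"
proof -
  define z where "z = \<i> * complex_of_real y"
  have z: "Im z \<ge> 0" using y by (simp add: z_def)
  define p' where "p' s = \<i> * z * p z s - cnj (a s) * q z s" for s
  have "ac_deriv R (p z) p'" using col2[of z] unfolding krein_pair_def p'_def by blast
  then have "ac_deriv r (p z) p'" by (rule ac_deriv_subinterval) (use r in simp)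
  then have "ac_deriv r (\<lambda>s. cnj (p z s) * p z s) (\<lambda>s. cnj (p z s) * p' s + cnj (p' s) * p z s)"
    using ac_deriv_mult[OF ac_deriv_cnj] by blast
  from has_integral_Re[OF ac_deriv_has_integral[OF this]]
  have 1: "((\<lambda>s. Re (cnj (p z s) * p' s + cnj (p' s) * p z s)) has_integral Re (cnj (p z r) * p z r)) {0..r}"
    using r by (simp add: col2_0)
  have 2: "((\<lambda>s. - y * (cmod (p z s))\<^sup>2 + K / y * (cmod (a s))\<^sup>2) has_integral
      - y * integral {0..r} (\<lambda>s. (cmod (p z s))\<^sup>2) + K / y * integral {0..r} (\<lambda>s. (cmod (a s))\<^sup>2)) {0..r}"
    using r by (intro has_integral_add has_integral_mult_right integrable_integral p_sq_integrable a_sq_integrable)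
  have le: "Re (cnj (p z s) * p' s + cnj (p' s) * p z s) \<le> - y * (cmod (p z s))\<^sup>2 + K / y * (cmod (a s))\<^sup>2"
    if s: "s \<in> {0..r}" for s
  proof -
    define u where "u = cnj (p z s) * cnj (a s) * q z s"
    have "Re (cnj (p z s) * p' s + cnj (p' s) * p z s) = 2 * Re (cnj (p z s) * p' s)"
      by (simp add: algebra_simps)
    moreover have "cnj (p z s) * p' s = - of_real (y * (cmod (p z s))\<^sup>2) - u"
      unfolding p'_def u_def z_def of_real_mult complex_norm_square by (simp add: algebra_simps)
    ultimately have eq: "Re (cnj (p z s) * p' s + cnj (p' s) * p z s) = - 2 * y * (cmod (p z s))\<^sup>2 - 2 * Re u"
      by (simp del: of_real_mult of_real_power)
    have "- 2 * Re u \<le> 2 * cmod u" using abs_Re_le_cmod[of u] by linarith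
    also have "\<dots> = 2 * (y * cmod (p z s)) * (cmod (a s) * cmod (q z s)) / y"
      using y by (simp add: u_def norm_mult)
    also have "\<dots> \<le> ((y * cmod (p z s))\<^sup>2 + (cmod (a s) * cmod (q z s))\<^sup>2) / y"
      using y by (intro divide_right_mono sum_squares_bound) auto
    also have "\<dots> = y * (cmod (p z s))\<^sup>2 + (cmod (a s))\<^sup>2 * (cmod (q z s))\<^sup>2 / y"
      using y by (simp add: power_mult_distrib power2_eq_square add_divide_distrib)
    also have "\<dots> \<le> y * (cmod (p z s))\<^sup>2 + (cmod (a s))\<^sup>2 * K / y"
      using y s r norm_q_sq_le[of s z] z by (intro add_left_mono divide_right_mono mult_left_mono) auto
    finally show ?thesis unfolding eq by (simp add: mult.commute)
  qed
  have "Re (cnj (p z r) * p z r) \<le> - y * integral {0..r} (\<lambda>s. (cmod (p z s))\<^sup>2) + K / y * integral {0..r} (\<lambda>s. (cmod (a s))\<^sup>2)"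
    by (rule has_integral_le[OF 1 2 le])
  also have "K / y * integral {0..r} (\<lambda>s. (cmod (a s))\<^sup>2) \<le> K / y * c"
    using K_pos y by (intro mult_left_mono a_sq_integral_le r) auto
  also have "Re (cnj (p z r) * p z r) = (cmod (p z r))\<^sup>2"
    by (simp add: cmod_power2) (simp add: power2_eq_square)
  finally show ?thesis unfolding z_def[symmetric] by simp
qed

text \<open>On a bounded interval L^2 lies in L^1, here through the majorant 1 + |a|^2 of
  |a|.\<close>

lemma integrable_continuous_times_cnj_a:
  assumes f: "continuous_on {0..R} f"
  shows "(\<lambda>s. f s * cnj (a s)) integrable_on {0..R}"
proof -
  let ?M = "lebesgue_on {0..R}"
  interpret finite_measure ?M by (rule finite_measure_lebesgue_on_Icc)
  obtain B where B: "\<And>s. s \<in> {0..R} \<Longrightarrow> cmod (f s) \<le> B" using continuous_on_Icc_bounded[OF f] by auto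
  have "f \<in> borel_measurable ?M" by (rule continuous_imp_measurable_on_sets_lebesgue[OF f]) simp
  moreover have "(\<lambda>s. cnj (a s)) \<in> borel_measurable ?M"
    by (rule borel_measurable_continuous_on[OF _ a_meas]) (intro continuous_intros)
  ultimately have m: "(\<lambda>s. f s * cnj (a s)) \<in> borel_measurable ?M" by (rule borel_measurable_times)
  have i: "integrable ?M (\<lambda>s. B * (1 + (cmod (a s))\<^sup>2))"
    by (intro integrable_mult_right Bochner_Integration.integrable_add a_L2) simp
  have "integrable ?M (\<lambda>s. f s * cnj (a s))"
  proof (rule Bochner_Integration.integrable_bound[OF i m], rule AE_I2)
    fix s assume "s \<in> space ?M"
    then have s: "cmod (f s) \<le> B" using B by simp
    have "2 * cmod (a s) \<le> 1 + (cmod (a s))\<^sup>2"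
      using sum_squares_bound[of 1 "cmod (a s)"] by simp
    then have "cmod (a s) \<le> 1 + (cmod (a s))\<^sup>2" using norm_ge_zero[of "a s"] by linarith
    then have "cmod (f s) * cmod (a s) \<le> B * (1 + (cmod (a s))\<^sup>2)"
      using s order_trans[OF norm_ge_zero s] by (intro mult_mono) auto
    then show "norm (f s * cnj (a s)) \<le> norm (B * (1 + (cmod (a s))\<^sup>2))"
      by (simp add: norm_mult)
  qed
  then show ?thesis by (rule integrable_on_lebesgue_on) simp
qed

text \<open>The terms that do not vanish as \<open>y\<close> grows are controlled by the \<open>L\<^sup>2\<close> distance of \<open>\<phi>\<close> to \<open>a\<close>; the
  others come from integrating \<open>(\<phi> p)'\<close>.\<close>

lemma q_expansion_estimate:
  fixes \<phi> \<phi>' :: "real \<Rightarrow> complex"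
  assumes y: "y > 0"
    and \<phi>: "\<And>s. (\<phi> has_vector_derivative \<phi>' s) (at s)" "continuous_on UNIV \<phi>'"
    and B: "\<And>s. s \<in> {0..R} \<Longrightarrow> cmod (\<phi> s) \<le> B" "\<And>s. s \<in> {0..R} \<Longrightarrow> cmod (\<phi>' s) \<le> B"
    and D: "(\<lambda>s. (cmod (a s - \<phi> s))\<^sup>2) integrable_on {0..R}"
      "integral {0..R} (\<lambda>s. (cmod (a s - \<phi> s))\<^sup>2) \<le> \<delta>\<^sup>2" "\<delta> \<ge> 0"
  shows "cmod (y * (q (\<i> * y) R - 1) - c) \<le>
    \<delta> * (sqrt (K * c) + sqrt c) + B * (1 + R) * sqrt (K * c / y) + B * c * sqrt (c * K * R) / y"
proof -
  define P where "P = p (\<i> * y)"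
  define Q where "Q = q (\<i> * y)"
  have z: "Im (\<i> * complex_of_real y) \<ge> 0" using y by simp
  have RR: "R \<in> {0..R}" using R by simp
  have B0: "B \<ge> 0" using B(1)[OF RR] norm_ge_zero order_trans by blast
  have cP: "continuous_on {0..R} P" and cQ: "continuous_on {0..R} Q"
    unfolding P_def Q_def by (rule continuous_entries)+
  have \<phi>c: "continuous_on {0..R} \<phi>"
    using \<phi>(1) has_vector_derivative_continuous by (intro continuous_at_imp_continuous_on) blast
  have \<phi>'c: "continuous_on {0..R} \<phi>'" using \<phi>(2) by (rule continuous_on_subset) simp
  \<comment> \<open>So \<open>y * P\<close> is bounded in L^2 uniformly in \<open>y\<close>, which
    is what allows \<open>S1\<close> below to be bounded by a multiple of \<open>\<delta>\<close>
    independent of \<open>y\<close>.\<close>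
  have intP: "y\<^sup>2 * integral {0..R} (\<lambda>s. (cmod (P s))\<^sup>2) \<le> K * c"
  proof -
    have "y * integral {0..R} (\<lambda>s. (cmod (P s))\<^sup>2) \<le> K * c / y"
      using p_decay[OF y RR] zero_le_power2[of "cmod (P R)"] unfolding P_def by linarith
    then show ?thesis using y by (simp add: field_simps power2_eq_square)
  qed
  have P_le: "cmod (P s) \<le> sqrt (K * c / y)" if s: "s \<in> {0..R}" for s
  proof (rule real_le_rsqrt)
    have "0 \<le> y * integral {0..s} (\<lambda>s. (cmod (P s))\<^sup>2)"
      using y p_sq_integral_nonneg[OF s] unfolding P_def by simp
    then show "(cmod (P s))\<^sup>2 \<le> K * c / y" using p_decay[OF y s] unfolding P_def by linarith
  qed
  have Q_le: "(cmod (Q s - 1))\<^sup>2 \<le> c * (K * c / y\<^sup>2)" if s: "s \<in> {0..R}" for s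
  proof -
    have "integral {0..s} (\<lambda>s. (cmod (P s))\<^sup>2) \<le> integral {0..R} (\<lambda>s. (cmod (P s))\<^sup>2)"
      unfolding P_def using s RR by (intro integral_subset_le p_sq_integrable) auto
    also have "\<dots> \<le> K * c / y\<^sup>2" using intP y by (simp add: field_simps)
    finally have "c * integral {0..s} (\<lambda>s. (cmod (P s))\<^sup>2) \<le> c * (K * c / y\<^sup>2)"
      using c_nonneg by (rule mult_left_mono)
    then show ?thesis using norm_q_minus_one_sq[OF s, of "\<i> * y"] unfolding P_def Q_def by linarith
  qed
  have aP: "((\<lambda>s. - a s * P s) has_integral Q R - 1) {0..R}"
    unfolding P_def Q_def by (rule has_integral_q[OF RR])
  have aa: "((\<lambda>s. a s * cnj (a s)) has_integral of_real c) {0..R}"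
  proof -
    have "((\<lambda>s. (cmod (a s))\<^sup>2) has_integral c) {0..R}"
      unfolding c_def by (intro integrable_integral a_sq_integrable RR)
    from has_integral_of_real[OF this, where 'b = complex] show ?thesis
      by (simp only: complex_norm_square)
  qed
  have \<phi>P: "((\<lambda>s. \<phi> s * (\<i> * (\<i> * y) * P s - cnj (a s) * Q s) + \<phi>' s * P s) has_integral \<phi> R * P R) {0..R}"
    using ac_deriv_has_integral[OF ac_deriv_mult[OF ac_deriv_smooth[OF \<phi>]
          conjunct1[OF col2[unfolded krein_pair_def, of "\<i> * y"]]]] R
    unfolding P_def Q_def by (simp add: col2_0)
  have iT1: "(\<lambda>s. \<phi>' s * P s) integrable_on {0..R}"
    by (intro integrable_continuous_interval continuous_intros \<phi>'c cP)
  have iT2: "(\<lambda>s. \<phi> s * (Q s - 1) * cnj (a s)) integrable_on {0..R}"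
    by (intro integrable_continuous_times_cnj_a continuous_intros \<phi>c cQ)
  have iS1: "(\<lambda>s. (a s - \<phi> s) * (y * P s)) integrable_on {0..R}"
  proof -
    have "(\<lambda>s. - y * (- a s * P s) - y * (\<phi> s * P s)) integrable_on {0..R}"
      by (intro integrable_diff integrable_on_mult_right has_integral_integrable[OF aP]
          integrable_continuous_interval continuous_on_mult \<phi>c cP)
    then show ?thesis by (rule integrable_eq) (simp add: algebra_simps)
  qed
  have iS2: "(\<lambda>s. (a s - \<phi> s) * cnj (a s)) integrable_on {0..R}"
    unfolding left_diff_distrib
    by (intro integrable_diff has_integral_integrable[OF aa] integrable_continuous_times_cnj_a \<phi>c)
  \<comment> \<open>\<open>S1\<close> and \<open>S2\<close> are the costs of replacing
    \<open>a\<close> by \<open>\<phi>\<close> in the integrals of a y P and of |a|^2.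
    \<open>T1\<close> is the term of (\<phi> P)' that contains \<phi>', and \<open>T2\<close> comes
    from replacing \<open>Q\<close> by 1 in the forcing term of P'.\<close>
  define S1 S2 T1 T2 where
    "S1 = integral {0..R} (\<lambda>s. (a s - \<phi> s) * (y * P s))"
    "S2 = integral {0..R} (\<lambda>s. (a s - \<phi> s) * cnj (a s))"
    "T1 = integral {0..R} (\<lambda>s. \<phi>' s * P s)"
    "T2 = integral {0..R} (\<lambda>s. \<phi> s * (Q s - 1) * cnj (a s))"
  note ST = this
  have I: "((\<lambda>s. - ((a s - \<phi> s) * (y * P s)) - (a s - \<phi> s) * cnj (a s)
        + (\<phi> s * (\<i> * (\<i> * y) * P s - cnj (a s) * Q s) + \<phi>' s * P s)
        - \<phi>' s * P s + \<phi> s * (Q s - 1) * cnj (a s)) has_integral - S1 - S2 + \<phi> R * P R - T1 + T2) {0..R}"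
    unfolding ST by (intro has_integral_add has_integral_diff has_integral_neg integrable_integral \<phi>P iT1 iT2 iS1 iS2)
  have J: "((\<lambda>s. y * (- a s * P s) - a s * cnj (a s)) has_integral y * (Q R - 1) - c) {0..R}"
    by (intro has_integral_diff has_integral_mult_right aP aa)
  have "(\<lambda>s. - ((a s - \<phi> s) * (y * P s)) - (a s - \<phi> s) * cnj (a s)
        + (\<phi> s * (\<i> * (\<i> * y) * P s - cnj (a s) * Q s) + \<phi>' s * P s)
        - \<phi>' s * P s + \<phi> s * (Q s - 1) * cnj (a s)) = (\<lambda>s. y * (- a s * P s) - a s * cnj (a s))"
    by (simp add: fun_eq_iff algebra_simps)
  then have eq: "y * (Q R - 1) - c = - S1 - S2 + \<phi> R * P R - T1 + T2"
    using has_integral_unique[OF J] I by (simp only:)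
  have "(cmod S1)\<^sup>2 \<le> (\<delta> * sqrt (K * c))\<^sup>2"
  proof -
    have i: "(\<lambda>s. (y * cmod (P s))\<^sup>2) integrable_on {0..R}"
      by (intro integrable_continuous_interval continuous_intros cP)
    have "(cmod S1)\<^sup>2 \<le> integral {0..R} (\<lambda>s. (cmod (a s - \<phi> s))\<^sup>2) * integral {0..R} (\<lambda>s. (y * cmod (P s))\<^sup>2)"
      unfolding ST using y by (intro integral_Cauchy_Schwarz iS1 D(1) i) (simp add: norm_mult)
    also have "integral {0..R} (\<lambda>s. (y * cmod (P s))\<^sup>2) = y\<^sup>2 * integral {0..R} (\<lambda>s. (cmod (P s))\<^sup>2)"
      by (simp add: power_mult_distrib)
    also have "integral {0..R} (\<lambda>s. (cmod (a s - \<phi> s))\<^sup>2) * \<dots> \<le> \<delta>\<^sup>2 * (K * c)"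
      using p_sq_integral_nonneg[OF RR] unfolding P_def
      by (intro mult_mono[OF D(2) intP[unfolded P_def]]) auto
    finally show ?thesis using K_pos c_nonneg by (simp add: power_mult_distrib)
  qed
  then have S1: "cmod S1 \<le> \<delta> * sqrt (K * c)"
    using D(3) K_pos c_nonneg by (intro power2_le_imp_le[of "cmod S1"]) auto
  have "(cmod S2)\<^sup>2 \<le> (\<delta> * sqrt c)\<^sup>2"
  proof -
    have "(cmod S2)\<^sup>2 \<le> integral {0..R} (\<lambda>s. (cmod (a s - \<phi> s))\<^sup>2) * integral {0..R} (\<lambda>s. (cmod (a s))\<^sup>2)"
      unfolding ST by (intro integral_Cauchy_Schwarz iS2 D(1) a_sq_integrable RR) (simp add: norm_mult)
    also have "\<dots> \<le> \<delta>\<^sup>2 * c"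
      unfolding c_def[symmetric] using D(2) c_nonneg by (rule mult_right_mono)
    finally show ?thesis using c_nonneg by (simp add: power_mult_distrib)
  qed
  then have S2: "cmod S2 \<le> \<delta> * sqrt c"
    using D(3) c_nonneg by (intro power2_le_imp_le[of "cmod S2"]) auto
  have bd: "cmod (\<phi> R * P R) \<le> B * sqrt (K * c / y)"
    unfolding norm_mult using B0 by (intro mult_mono B P_le RR) auto
  have "cmod T1 \<le> B * sqrt (K * c / y) * (R - 0)"
    unfolding ST using R B0 by (intro integral_bound continuous_intros \<phi>'c cP) (auto simp: norm_mult intro!: mult_mono B P_le)
  then have T1: "cmod T1 \<le> B * R * sqrt (K * c / y)" by (simp add: algebra_simps)
  have "(cmod T2)\<^sup>2 \<le> (B * c * sqrt (c * K * R) / y)\<^sup>2"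
  proof -
    have i: "(\<lambda>s. (cmod (\<phi> s * (Q s - 1)))\<^sup>2) integrable_on {0..R}"
      by (intro integrable_continuous_interval continuous_intros \<phi>c cQ)
    have "(cmod T2)\<^sup>2 \<le> integral {0..R} (\<lambda>s. (cmod (\<phi> s * (Q s - 1)))\<^sup>2) * integral {0..R} (\<lambda>s. (cmod (a s))\<^sup>2)"
      unfolding ST by (intro integral_Cauchy_Schwarz iT2 i a_sq_integrable RR) (simp add: norm_mult)
    also have "\<dots> \<le> integral {0..R} (\<lambda>s. B\<^sup>2 * (c * (K * c / y\<^sup>2))) * c"
      unfolding c_def[symmetric]
    proof (intro mult_right_mono integral_le i)
      fix s assume s: "s \<in> {0..R}"
      show "(cmod (\<phi> s * (Q s - 1)))\<^sup>2 \<le> B\<^sup>2 * (c * (K * c / y\<^sup>2))"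
        unfolding norm_mult power_mult_distrib using B(1)[OF s] Q_le[OF s] by (intro mult_mono power_mono) auto
    qed (use c_nonneg in auto)
    also have "\<dots> = (B * c * sqrt (c * K * R) / y)\<^sup>2"
      using R K_pos c_nonneg by (simp add: power_mult_distrib power_divide power2_eq_square)
    finally show ?thesis .
  qed
  then have T2: "cmod T2 \<le> B * c * sqrt (c * K * R) / y"
    using B0 c_nonneg K_pos R y by (intro power2_le_imp_le[of "cmod T2"]) auto
  have "cmod (y * (Q R - 1) - c) \<le> cmod S1 + cmod S2 + cmod (\<phi> R * P R) + cmod T1 + cmod T2"
    unfolding eq
    using norm_triangle_ineq[of "- S1 - S2 + \<phi> R * P R - T1" T2] norm_triangle_ineq4[of "- S1 - S2 + \<phi> R * P R" T1]
      norm_triangle_ineq[of "- S1 - S2" "\<phi> R * P R"] norm_triangle_ineq4[of "- S1" S2] norm_minus_cancel[of S1]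
    by linarith
  also have "\<dots> \<le> \<delta> * sqrt (K * c) + \<delta> * sqrt c + B * sqrt (K * c / y) + B * R * sqrt (K * c / y) + B * c * sqrt (c * K * R) / y"
    by (intro add_mono S1 S2 bd T1 T2)
  finally show ?thesis unfolding Q_def by (simp add: algebra_simps)
qed

lemma q_first_order_asymptotics: "(\<lambda>n. real n * (q (\<i> * real n) R - 1)) \<longlonglongrightarrow> of_real c"
proof (rule LIMSEQ_I)
  fix e :: real assume e: "e > 0"
  \<comment> \<open>The summand 1 keeps \<open>k\<close> positive when \<open>c = 0\<close>.\<close>
  define k where "k = sqrt (K * c) + sqrt c + 1"
  define \<delta> where "\<delta> = e / (2 * k)"
  have "sqrt (K * c) \<ge> 0" "sqrt c \<ge> 0" using K_pos c_nonneg by auto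
  then have k: "k > 0" unfolding k_def by linarith
  have \<delta>: "\<delta> > 0" using e k by (simp add: \<delta>_def)
  have "\<delta> * (sqrt (K * c) + sqrt c) \<le> \<delta> * k" using \<delta> by (intro mult_left_mono) (auto simp: k_def)
  also have "\<dots> = e / 2" using k by (simp add: \<delta>_def)
  finally have \<delta>_le: "\<delta> * (sqrt (K * c) + sqrt c) \<le> e / 2" .
  obtain \<phi> where \<phi>: "polynomial_function \<phi>" "integrable (lebesgue_on {0..R}) (\<lambda>r. (cmod (a r - \<phi> r))\<^sup>2)"
    "(LINT r|lebesgue_on {0..R}. (cmod (a r - \<phi> r))\<^sup>2) < \<delta>\<^sup>2"
    using L2_polynomial_approximation[OF a_meas a_L2, of "\<delta>\<^sup>2"] \<delta> by auto
  obtain \<phi>' where \<phi>': "polynomial_function \<phi>'" "\<And>x. (\<phi> has_vector_derivative \<phi>' x) (at x)"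
    using has_vector_derivative_polynomial_function[OF \<phi>(1)] by auto
  have cont: "continuous_on S \<phi>" "continuous_on S \<phi>'" for S
    using \<phi>(1) \<phi>'(1) by (auto intro: continuous_on_polymonial_function)
  obtain B1 where B1: "\<And>s. s \<in> {0..R} \<Longrightarrow> cmod (\<phi> s) \<le> B1" using continuous_on_Icc_bounded[OF cont(1)] by auto
  obtain B2 where B2: "\<And>s. s \<in> {0..R} \<Longrightarrow> cmod (\<phi>' s) \<le> B2" using continuous_on_Icc_bounded[OF cont(2)] by auto
  define B where "B = max B1 B2"
  have B: "\<And>s. s \<in> {0..R} \<Longrightarrow> cmod (\<phi> s) \<le> B" "\<And>s. s \<in> {0..R} \<Longrightarrow> cmod (\<phi>' s) \<le> B"
    using B1 B2 by (auto simp: B_def le_max_iff_disj)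
  have D: "(\<lambda>s. (cmod (a s - \<phi> s))\<^sup>2) integrable_on {0..R}"
    "integral {0..R} (\<lambda>s. (cmod (a s - \<phi> s))\<^sup>2) \<le> \<delta>\<^sup>2"
    using integrable_on_lebesgue_on[OF \<phi>(2)] lebesgue_integral_eq_integral[OF \<phi>(2)] \<phi>(3) by simp_all
  \<comment> \<open>\<open>B\<close> depends on \<open>\<delta>\<close> through the chosen
    polynomial, but \<open>\<delta>\<close> is now fixed, so \<open>T\<close> tends to 0.\<close>
  define T where "T n = B * (1 + R) * sqrt (K * c / real n) + B * c * sqrt (c * K * R) / real n" for n
  have "T \<longlonglongrightarrow> B * (1 + R) * sqrt 0 + 0"
    unfolding T_def by (intro tendsto_add tendsto_mult tendsto_const tendsto_real_sqrt lim_const_over_n)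
  then have "T \<longlonglongrightarrow> 0" by simp
  then have "\<forall>\<^sub>F n in sequentially. T n < e / 2" using e by (intro order_tendstoD(2)) auto
  then obtain N where N: "\<And>n. n \<ge> N \<Longrightarrow> T n < e / 2" by (auto simp: eventually_sequentially)
  show "\<exists>no. \<forall>n\<ge>no. norm (real n * (q (\<i> * real n) R - 1) - of_real c) < e"
  proof (intro exI[of _ "max N 1"] allI impI)
    fix n assume n: "n \<ge> max N 1"
    then have "real n > 0" by simp
    from q_expansion_estimate[OF this \<phi>'(2) cont(2) B D less_imp_le[OF \<delta>]]
    have "cmod (real n * (q (\<i> * real n) R - 1) - of_real c) \<le> \<delta> * (sqrt (K * c) + sqrt c) + T n"
      by (simp add: T_def)
    then show "norm (real n * (q (\<i> * real n) R - 1) - of_real c) < e"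
      using N[of n] n \<delta>_le by simp
  qed
qed

text \<open>It is convenient to expand v = |q|^2 - 1, a polynomial in the real and imaginary parts
  of u = q - 1. As n u converges, |u|^2 is of second order and n v tends to 2 c; then v - v^2 <=
  ln(1 + v) <= v squeezes n ln(1 + v) = 2 n ln |q|.\<close>

lemma ln_norm_q_asymptotics: "(\<lambda>n. real n * ln (cmod (q (\<i> * real n) R))) \<longlonglongrightarrow> c"
proof -
  define u where "u n = q (\<i> * real n) R - 1" for n :: nat
  define v where "v n = (cmod (q (\<i> * real n) R))\<^sup>2 - 1" for n :: nat
  have RR: "R \<in> {0..R}" using R by simp
  have v0: "v n \<ge> 0" for n
    using norm_q_ge(1)[OF RR, of "\<i> * real n"] by (simp add: v_def)
  have nu: "(\<lambda>n. real n * u n) \<longlonglongrightarrow> of_real c" unfolding u_def by (rule q_first_order_asymptotics)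
  have v: "v n = 2 * Re (u n) + (cmod (u n))\<^sup>2" for n
    unfolding v_def u_def cmod_power2 by (simp add: power2_eq_square algebra_simps)
  have "(\<lambda>n. 2 * Re (real n * u n) + (cmod (real n * u n))\<^sup>2 * (1 / real n)) \<longlonglongrightarrow> 2 * Re (of_real c) + (cmod (of_real c))\<^sup>2 * 0"
    by (intro tendsto_intros nu tendsto_Re lim_const_over_n)
  moreover have "\<forall>\<^sub>F n in sequentially. 2 * Re (real n * u n) + (cmod (real n * u n))\<^sup>2 * (1 / real n) = real n * v n"
    by (rule eventually_sequentiallyI[of 1]) (simp add: v norm_mult power2_eq_square algebra_simps)
  ultimately have nv: "(\<lambda>n. real n * v n) \<longlonglongrightarrow> 2 * c" by (simp add: tendsto_cong)
  have lower: "(\<lambda>n. real n * v n - (real n * v n)\<^sup>2 * (1 / real n)) \<longlonglongrightarrow> 2 * c - (2 * c)\<^sup>2 * 0"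
    by (intro tendsto_intros nv lim_const_over_n)
  \<comment> \<open>The lower bound v - v^2 for the logarithm is available for 0 <= v <= 1.\<close>
  have ev1: "\<forall>\<^sub>F n in sequentially. v n \<le> 1"
  proof -
    have "(\<lambda>n. real n * v n * (1 / real n)) \<longlonglongrightarrow> 2 * c * 0"
      by (intro tendsto_mult nv lim_const_over_n)
    then have "\<forall>\<^sub>F n in sequentially. real n * v n * (1 / real n) < 1" by (intro order_tendstoD(2)) auto
    then show ?thesis using eventually_gt_at_top[of 0] by eventually_elim auto
  qed
  have "(\<lambda>n. real n * ln (1 + v n)) \<longlonglongrightarrow> 2 * c"
  proof (rule tendsto_sandwich[OF _ _ _ nv])
    show "(\<lambda>n. real n * v n - (real n * v n)\<^sup>2 * (1 / real n)) \<longlonglongrightarrow> 2 * c" using lower by simp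
    show "\<forall>\<^sub>F n in sequentially. real n * ln (1 + v n) \<le> real n * v n"
      using v0 by (intro always_eventually allI mult_left_mono ln_add_one_self_le_self) auto
    show "\<forall>\<^sub>F n in sequentially. real n * v n - (real n * v n)\<^sup>2 * (1 / real n) \<le> real n * ln (1 + v n)"
      using ev1 eventually_gt_at_top[of 0]
    proof eventually_elim
      case (elim n)
      have "real n * (v n - (v n)\<^sup>2) \<le> real n * ln (1 + v n)"
        using ln_one_plus_pos_lower_bound[OF v0 elim(1)] by (intro mult_left_mono) auto
      then show ?case using elim(2) by (simp add: power2_eq_square algebra_simps)
    qed
  qed
  moreover have "ln (1 + v n) = 2 * ln (cmod (q (\<i> * real n) R))" for n
    using norm_q_ge(1)[OF RR, of "\<i> * real n"] by (simp add: v_def ln_realpow)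
  ultimately have "(\<lambda>n. real n * (2 * ln (cmod (q (\<i> * real n) R))) / 2) \<longlonglongrightarrow> 2 * c / 2"
    by (intro tendsto_divide tendsto_const) simp_all
  then show ?thesis by simp
qed

section \<open>Integrals over the real line\<close>

text \<open>Multiplied by \<pi> y, the Poisson kernel becomes y^2 / (y^2 + t^2), which increases to
  1 with y. Because ln |q| >= 0, monotone convergence delivers the integrability of ln |q| together
  with the value of its integral.\<close>

theorem integral_ln_norm_q:
  "integrable lebesgue (\<lambda>t::real. ln (cmod (q t R)))" "(LINT t::real|lebesgue. ln (cmod (q t R))) = pi * c"
proof -
  define l where "l t = ln (cmod (q (of_real t) R))" for t :: real
  \<comment> \<open>The heights \<open>Suc n\<close> avoid y = 0, where the kernel would
    degenerate.\<close>
  define f where "f n t = (real (Suc n))\<^sup>2 / ((real (Suc n))\<^sup>2 + t\<^sup>2) * l t" for n t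
  have RR: "R \<in> {0..R}" using R by simp
  have ge: "1 \<le> cmod (q (of_real t) R)" for t :: real using norm_q_ge(1)[OF RR, of "of_real t"] by simp
  then have l0: "l t \<ge> 0" for t by (simp add: l_def)
  have pos: "(real (Suc n))\<^sup>2 + t\<^sup>2 > 0" for n t by (simp add: add_pos_nonneg)
  have f: "f n = (\<lambda>t. (pi * real (Suc n)) * (real (Suc n) / (pi * ((real (Suc n))\<^sup>2 + t\<^sup>2)) * ln (cmod (q t R))))" for n
    by (simp add: fun_eq_iff f_def l_def power2_eq_square del: of_nat_Suc)
  have fi: "integrable lebesgue (f n)" for n
    unfolding f using poisson_q(1)[of "real (Suc n)"] by (intro integrable_mult_right) simp
  have fI: "(LINT t|lebesgue. f n t) = pi * (real (Suc n) * ln (cmod (q (\<i> * real (Suc n)) R)))" for n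
    unfolding f integral_mult_right_zero using poisson_q(2)[of "real (Suc n)"]
    by (simp only: of_nat_0_less_iff zero_less_Suc mult.assoc simp_thms)
  have "(\<lambda>n. LINT t|lebesgue. f n t) \<longlonglongrightarrow> pi * c"
    unfolding fI by (intro tendsto_mult tendsto_const LIMSEQ_Suc[OF ln_norm_q_asymptotics])
  moreover have "mono (\<lambda>n. f n t)" for t
  proof (rule monoI)
    fix m n :: nat assume mn: "m \<le> n"
    define x y where "x = (real (Suc m))\<^sup>2" and "y = (real (Suc n))\<^sup>2"
    have xy: "x > 0" "x \<le> y" using mn by (auto simp: x_def y_def intro: power_mono)
    then have "x * t\<^sup>2 \<le> y * t\<^sup>2" by (intro mult_right_mono) auto
    then have "x / (x + t\<^sup>2) \<le> y / (y + t\<^sup>2)"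
      using xy by (simp add: divide_le_eq le_divide_eq add_pos_nonneg algebra_simps)
    then show "f m t \<le> f n t" unfolding f_def x_def y_def using l0 by (intro mult_right_mono)
  qed
  moreover have "(\<lambda>n. f n t) \<longlonglongrightarrow> l t" for t
  proof -
    have "(\<lambda>n. 1 / (1 + (t * (1 / real (Suc n)))\<^sup>2) * l t) \<longlonglongrightarrow> 1 / (1 + (t * 0)\<^sup>2) * l t"
      by (intro tendsto_intros LIMSEQ_Suc[OF lim_const_over_n]) simp
    moreover have "1 / (1 + (t * (1 / real (Suc n)))\<^sup>2) * l t = f n t" for n
    proof -
      have "1 + (t * (1 / real (Suc n)))\<^sup>2 = ((real (Suc n))\<^sup>2 + t\<^sup>2) / (real (Suc n))\<^sup>2"
        by (simp add: power_divide add_divide_distrib del: of_nat_Suc)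
      then show ?thesis by (simp add: f_def del: of_nat_Suc)
    qed
    ultimately show ?thesis by simp
  qed
  moreover have "l \<in> borel_measurable lebesgue"
  proof -
    have "q (of_real t) R \<noteq> 0" for t :: real using ge[of t] by auto
    moreover have "continuous_on UNIV (\<lambda>t::real. q (of_real t) R)"
      by (rule continuous_on_compose2[OF continuous_on_q]) (auto intro: continuous_intros)
    ultimately have "continuous_on UNIV l"
      unfolding l_def by (intro continuous_on_ln continuous_on_norm) auto
    then show ?thesis
      using continuous_imp_measurable_on_sets_lebesgue[of UNIV l] by (simp add: lebesgue_on_UNIV_eq)
  qed
  ultimately have "has_bochner_integral lebesgue l (pi * c)"
    using fi by (intro has_bochner_integral_monotone_convergence[where f = f]) auto
  then show "integrable lebesgue (\<lambda>t::real. ln (cmod (q t R)))" "(LINT t::real|lebesgue. ln (cmod (q t R))) = pi * c"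
    unfolding l_def by (auto simp: has_bochner_integral_iff)
qed

text \<open>For real t the matrix preserves the form diag(1, -1). This gives relations within
  columns, |\<alpha>|^2 = 1 + |\<beta>|^2 and |q|^2 = 1 + |p|^2, while the claim concerns the second
  row. Orthogonality of the columns yields |\<alpha>| |p| = |\<beta>| |q|, and the three together
  force |p| = |\<beta>|.\<close>

lemma norm_identity_real_line:
  fixes t :: real
  shows "(cmod (q t R))\<^sup>2 - (cmod (\<beta> t R))\<^sup>2 = 1"
proof -
  have RR: "R \<in> {0..R}" "0 \<le> R" using R by auto
  define A B P Q where "A = (cmod (\<alpha> t R))\<^sup>2" "B = (cmod (\<beta> t R))\<^sup>2" "P = (cmod (p t R))\<^sup>2" "Q = (cmod (q t R))\<^sup>2"
  note d = this
  have n: "cnj u * u = of_real ((cmod u)\<^sup>2)" for u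
    by (simp only: complex_norm_square mult.commute)
  have "((\<lambda>s. 0) has_integral cnj (\<alpha> t R) * \<alpha> t R - cnj (\<beta> t R) * \<beta> t R - 1) {0..R}"
    using ac_deriv_has_integral[OF krein_energy[OF col1[of t] col1[of t]] RR(2)] by (simp add: col1_0)
  then have 1: "A = 1 + B" unfolding n d by (simp add: has_integral_0_eq flip: of_real_power of_real_diff)
  have 2: "Q = 1 + P" using energy_identity[OF RR(1), of t] by (simp add: d)
  have "((\<lambda>s. 0) has_integral cnj (\<alpha> t R) * p t R - cnj (\<beta> t R) * q t R) {0..R}"
    using ac_deriv_has_integral[OF krein_energy[OF col1[of t] col2[of t]] RR(2)] by (simp add: col1_0 col2_0)
  then have "cnj (\<alpha> t R) * p t R = cnj (\<beta> t R) * q t R" by simp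
  then have "(cmod (cnj (\<alpha> t R) * p t R))\<^sup>2 = (cmod (cnj (\<beta> t R) * q t R))\<^sup>2" by simp
  then have "A * P = B * Q" by (simp add: d norm_mult power_mult_distrib)
  then have "P = B" unfolding 1 2 by (simp add: algebra_simps)
  then show ?thesis using 2 by (simp add: d)
qed

end

theorem theorem11p3:
  fixes R :: real
    and A :: "real \<Rightarrow> complex"
    and PA PB :: "real \<Rightarrow> complex \<Rightarrow> complex"
  assumes "R > 0"
    and "A \<in> borel_measurable (lebesgue_on {0..R})"
    and "integrable (lebesgue_on {0..R}) (\<lambda>r. (cmod (A r))\<^sup>2)"
    and "wall_polynomials R A PA PB"
  shows "integrable lebesgue (\<lambda>t::real. ln (cmod (PA R (of_real t))))
    \<and> (LINT t::real|lebesgue. ln (cmod (PA R (of_real t))))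
        = pi * (LINT r|lebesgue_on {0..R}. (cmod (A r))\<^sup>2)
    \<and> integrable lebesgue
        (\<lambda>t::real. ln (1 - (cmod (PB R (of_real t) * inverse (PA R (of_real t))))\<^sup>2))
    \<and> 2 * pi * (LINT r|lebesgue_on {0..R}. (cmod (A r))\<^sup>2)
        = - (LINT t::real|lebesgue.
               ln (1 - (cmod (PB R (of_real t) * inverse (PA R (of_real t))))\<^sup>2))"
proof -
  obtain X where X: "\<And>z. krein_solution R A z (\<lambda>r. X r z)"
    and PX: "\<And>r z. r \<in> {0..R} \<Longrightarrow> PB r z = vec_nth (vec_nth (X r z) 2) 1 \<and> PA r z = vec_nth (vec_nth (X r z) 2) 2"
    using assms(4) unfolding wall_polynomials_def by blast
  have X0: "X 0 z = mat 1" for z using X[of z] by (simp add: krein_solution_def)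
  interpret krein_system R A "\<lambda>z r. vec_nth (vec_nth (X r z) 1) 1" "\<lambda>z r. vec_nth (vec_nth (X r z) 2) 1"
    "\<lambda>z r. vec_nth (vec_nth (X r z) 1) 2" "\<lambda>z r. vec_nth (vec_nth (X r z) 2) 2"
    by unfold_locales (use assms krein_solution_column[OF X] in \<open>auto simp: X0 mat_def\<close>)
  have P: "PB R z = vec_nth (vec_nth (X R z) 2) 1" "PA R z = vec_nth (vec_nth (X R z) 2) 2" for z
    using PX[of R z] assms(1) by auto
  have c: "(LINT r|lebesgue_on {0..R}. (cmod (A r))\<^sup>2) = c"
    unfolding c_def by (rule lebesgue_integral_eq_integral[OF assms(3)]) simp
  note I = integral_ln_norm_q[folded P]
  \<comment> \<open>On the real line the second integrand is pointwise -2 times the first, so its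
    integrability and its integral both follow from the first formula.\<close>
  have "ln (1 - (cmod (PB R t * inverse (PA R t)))\<^sup>2) = - 2 * ln (cmod (PA R t))" for t :: real
  proof -
    have PA1: "cmod (PA R t) \<ge> 1"
      using norm_q_ge(1)[of R "of_real t"] assms(1) by (simp add: P)
    then have "(cmod (PA R t))\<^sup>2 \<noteq> 0" by auto
    moreover have "1 - y * inverse x = (x - y) / x" if "x \<noteq> 0" for x y :: real
      using that by (simp add: field_simps)
    ultimately have "1 - (cmod (PB R t * inverse (PA R t)))\<^sup>2 = ((cmod (PA R t))\<^sup>2 - (cmod (PB R t))\<^sup>2) / (cmod (PA R t))\<^sup>2"
      unfolding norm_mult norm_inverse power_mult_distrib power_inverse by blast
    also have "\<dots> = inverse ((cmod (PA R t))\<^sup>2)"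
      using norm_identity_real_line[of t, folded P] by (simp add: divide_inverse)
    finally show ?thesis using PA1 by (simp add: ln_inverse ln_realpow)
  qed
  then show ?thesis using I unfolding c by simp
qed

end
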